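(* Let $F=\mathbb{R}$ or $\mathbb{C}$. If $n\geq 2$ and $\varepsilon>0$, then $$\int_{N_{n}}a_{n}(v)^{-\rho_{n}}\bigl(1+\rho_n(\log a_{n}(v))\bigr)^{-\binom{n}{2}-\varepsilon}\,dv<\infty .$$
   Context: Let $G_n=SL(n,F)$, $K_n=SO(n)$ if $F=\mathbb{R}$ and $K_n=SU(n)$ if $F=\mathbb{C}$. $N_n$ is the group of upper triangular matrices in $G_n$ with ones on the main diagonal, $\bar N_n=N_n^T$, and $A_n$ is the group of diagonal matrices in $G_n$ with positive real entries. $G_n=\bar N_nA_nK_n$ is an Iwasawa decomposition; for $g\in G_n$ write uniquely $g=\bar n(g)\,a_n(g)\,k_n(g)$ with $\bar n(g)\in\bar N_n$, $a_n(g)\in A_n$, $k_n(g)\in K_n$. For $a\in A_n$, $a^{\rho_n}=\bigl(\det \mathrm{Ad}(a)|_{\mathrm{Lie}(N_n)}\bigr)^{1/2}$ (determinant over $\mathbb{R}$) and $\rho_n(\log a)=\log(a^{\rho_n})$. $dv$ is a Haar measure on $N_n$ (Lebesgue measure in the matrix entries $v_{ij}\in F$ with $1\le i<j\le n$). *)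

theory Defs
  imports
    "HOL-Analysis.Analysis"
    "Jordan_Normal_Form.Schur_Decomposition"
    "Jordan_Normal_Form.Gauss_Jordan_Elimination"
begin

text \<open>
  The field \<open>F\<close> is rendered as a type of the sort below, of which \<open>real\<close> and \<open>complex\<close> are
  instances; \<open>conjugate\<close> is the identity on \<open>real\<close> and complex conjugation on \<open>complex\<close>.
  Matrix indices run from \<open>0\<close> to \<open>n - 1\<close>.  Several constants are qualified because
  HOL-Analysis uses the same names for its type-indexed matrices.
\<close>

definition SL_grp :: "nat \<Rightarrow> 'a::comm_ring_1 mat set" where
  "SL_grp n = {g \<in> carrier_mat n n. Determinant.det g = 1}"

text \<open>\<open>SO(n)\<close> over \<open>real\<close>, \<open>SU(n)\<close> over \<open>complex\<close>.\<close>

definition K_grp :: "nat \<Rightarrow> 'a::conjugatable_field mat set" where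
  "K_grp n = {k \<in> SL_grp n. k * mat_adjoint k = 1\<^sub>m n}"

definition N_grp :: "nat \<Rightarrow> 'a::comm_ring_1 mat set" where
  "N_grp n = {v \<in> SL_grp n. upper_triangular v \<and> (\<forall>i<n. v $$ (i, i) = 1)}"

definition Nbar_grp :: "nat \<Rightarrow> 'a::comm_ring_1 mat set" where
  "Nbar_grp n = transpose_mat ` N_grp n"

definition A_grp :: "nat \<Rightarrow> 'a::{real_algebra_1, comm_ring_1} mat set" where
  "A_grp n = {a \<in> SL_grp n. diagonal_mat a \<and> (\<forall>i<n. \<exists>r>0. a $$ (i, i) = of_real r)}"

text \<open>
  The \<open>A\<close>-component of \<open>g = nbar * a * k\<close>; the description is proper on \<open>SL_grp n\<close> over
  \<open>real\<close> and \<open>complex\<close> by existence and uniqueness of the Iwasawa decomposition.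
\<close>

definition iwasawa_a :: "nat \<Rightarrow> 'a::{conjugatable_field, real_normed_field} mat \<Rightarrow> 'a mat" where
  "iwasawa_a n g =
     (THE a. a \<in> A_grp n \<and> (\<exists>nbar \<in> Nbar_grp n. \<exists>k \<in> K_grp n. g = nbar * a * k))"

definition Ad :: "'a::field mat \<Rightarrow> 'a mat \<Rightarrow> 'a mat" where
  "Ad g X = g * X * the (mat_inverse g)"

text \<open>
  \<open>Lie(N)\<close> is the space of strictly upper triangular matrices.  A real basis of it is indexed
  by triples \<open>(i, j, b)\<close> with \<open>i < j\<close> and \<open>b\<close> in the real basis of \<open>F\<close> (\<open>{1}\<close> or \<open>{1, \<i>}\<close>):
  the corresponding element has \<open>b\<close> at position \<open>(i, j)\<close> and zeros elsewhere.
  The determinant of a real-linear endomorphism does not depend on the enumeration chosen.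
\<close>

definition lie_N_index :: "nat \<Rightarrow> (nat \<times> nat \<times> 'a::euclidean_space) list" where
  "lie_N_index n = (SOME xs. distinct xs \<and> set xs = {(i, j, b). i < j \<and> j < n \<and> b \<in> Basis})"

definition lie_N_elem :: "nat \<Rightarrow> nat \<times> nat \<times> 'a::euclidean_space \<Rightarrow> 'a mat" where
  "lie_N_elem n = (\<lambda>(i, j, b). Matrix.mat n n (\<lambda>p. if p = (i, j) then b else 0))"

definition lie_N_coord :: "nat \<times> nat \<times> 'a::euclidean_space \<Rightarrow> 'a mat \<Rightarrow> real" where
  "lie_N_coord = (\<lambda>(i, j, b) X. inner (X $$ (i, j)) b)"

definition lie_N_det :: "nat \<Rightarrow> ('a::euclidean_space mat \<Rightarrow> 'a mat) \<Rightarrow> real" where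
  "lie_N_det n T =
     (let xs = lie_N_index n; m = length xs in
      Determinant.det (Matrix.mat m m (\<lambda>(r, c). lie_N_coord (xs ! r) (T (lie_N_elem n (xs ! c))))))"

text \<open>
  \<open>rho_pow n a\<close> is \<open>a\<^sup>\<rho>\<close>; for \<open>a\<close> in \<open>A_grp n\<close> the determinant is positive.
\<close>

definition rho_pow :: "nat \<Rightarrow> 'a::{field, euclidean_space} mat \<Rightarrow> real" where
  "rho_pow n a = sqrt (lie_N_det n (Ad a))"

definition rho_log :: "nat \<Rightarrow> 'a::{field, euclidean_space} mat \<Rightarrow> real" where
  "rho_log n a = ln (rho_pow n a)"

text \<open>
  Haar measure on \<open>N\<close>: Lebesgue measure in the entries \<open>v i j\<close>, \<open>i < j\<close>, transported to
  \<open>N_grp n\<close> along the bijection \<open>unip n\<close>.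
\<close>

definition upper_index :: "nat \<Rightarrow> (nat \<times> nat) set" where
  "upper_index n = {(i, j). i < j \<and> j < n}"

definition unip :: "nat \<Rightarrow> (nat \<times> nat \<Rightarrow> 'a::comm_ring_1) \<Rightarrow> 'a mat" where
  "unip n x = Matrix.mat n n (\<lambda>(i, j). if i < j then x (i, j) else if i = j then 1 else 0)"

definition haar_N :: "nat \<Rightarrow> 'a::{comm_ring_1, euclidean_space} mat measure" where
  "haar_N n = embed_measure (Pi\<^sub>M (upper_index n) (\<lambda>_. lborel)) (unip n)"

lemma inj_on_unip:
  "inj_on (unip n) (space (Pi\<^sub>M (upper_index n) (\<lambda>_. (lborel :: 'a::{comm_ring_1, euclidean_space} measure))))"
proof (rule inj_onI)
  fix x y :: "nat \<times> nat \<Rightarrow> 'a"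
  assume x: "x \<in> space (Pi\<^sub>M (upper_index n) (\<lambda>_. lborel))"
    and y: "y \<in> space (Pi\<^sub>M (upper_index n) (\<lambda>_. lborel))"
    and eq: "unip n x = unip n y"
  have "x (i, j) = y (i, j)" if "(i, j) \<in> upper_index n" for i j
    using that arg_cong[OF eq, of "\<lambda>M. M $$ (i, j)"] by (auto simp: unip_def upper_index_def)
  then show "x = y"
    using x y by (intro extensionalityI[of _ "upper_index n"]) (auto simp: space_PiM PiE_def)
qed

lemma space_haar_N: "space (haar_N n :: 'a::{comm_ring_1, euclidean_space} mat measure) = N_grp n"
proof -
  have unip_in: "unip n x \<in> N_grp n" for x :: "nat \<times> nat \<Rightarrow> 'a"
  proof -
    have c: "unip n x \<in> carrier_mat n n" by (simp add: unip_def)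
    have u: "upper_triangular (unip n x)" by (auto simp: unip_def)
    have "diag_mat (unip n x) = map (\<lambda>i. 1) [0..<n]"
      by (auto simp: diag_mat_def unip_def intro!: map_cong)
    then have "Determinant.det (unip n x) = 1"
      using det_upper_triangular[OF u c] by (simp add: map_replicate_const)
    then show ?thesis using c u by (auto simp: N_grp_def SL_grp_def unip_def)
  qed
  have "v \<in> unip n ` space (Pi\<^sub>M (upper_index n) (\<lambda>_. lborel))" if "v \<in> N_grp n" for v :: "'a mat"
  proof (rule image_eqI)
    show "v = unip n (\<lambda>p\<in>upper_index n. v $$ p)"
      using that by (intro eq_matI) (auto simp: N_grp_def SL_grp_def unip_def upper_index_def)
  qed (auto simp: space_PiM)
  then show ?thesis
    using unip_in by (auto simp: haar_N_def space_embed_measure)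
qed

end

theory Submission
  imports Defs
begin

text \<open>
  Write \<open>d\<close> for the real dimension of \<open>F\<close> and \<open>\<Delta>\<^sub>j(v)\<close> for the leading principal minors of \<open>v v\<^sup>*\<close>.
  Then \<open>a(v)\<^sup>\<rho> = (\<Delta>\<^sub>1 \<cdots> \<Delta>\<^sub>n\<^sub>-\<^sub>1)\<^bsup>d/2\<^esup>\<close>.  Append a last column \<open>u\<close> to \<open>V \<in> N\<^sub>m\<close>, and let \<open>L\<close> be the
  lower triangular factor of \<open>V = L k\<close>.  The substitution \<open>u = L y\<close> preserves Lebesgue measure,
  because \<open>det L = 1\<close>, and the new column multiplies \<open>\<Delta>\<^sub>j\<close> by \<open>s\<^sub>j = 1 + |y\<^sub>1|\<^sup>2 + \<cdots> + |y\<^sub>j|\<^sup>2\<close>.  Since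
  \<open>(1 + a + b)\<^sup>-\<^sup>p\<^sup>-\<^sup>q \<le> (1 + a)\<^sup>-\<^sup>p (1 + b)\<^sup>-\<^sup>q\<close> and \<open>s\<^sub>j \<ge> 1 + |y\<^sub>j|\<^sup>2\<close>, the exponent can be
  distributed so that each new coordinate receives slightly more than \<open>1\<close>.  The integral is thus
  bounded by the one for \<open>V\<close> times the \<open>m\<close>-th power of the convergent integral of
  \<open>(1 + |y|\<^sup>2)\<^bsup>-d/2\<^esup> (1 + (d/2) ln (1 + |y|\<^sup>2))\<^bsup>-1-\<delta>\<^esup>\<close> over \<open>F\<close>.
\<close>

subsection \<open>Real and complex scalars\<close>

text \<open>Treats both choices of F at once. The axiom ties conjugation to the norm: together with
  multiplicativity it makes conjugation fix the reals and preserve the norm.\<close>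

class rc_field = conjugatable_field + real_normed_field + euclidean_space +
  assumes mult_conjugate: "x * conjugate x = (norm x)\<^sup>2 *\<^sub>R 1"

instance real :: rc_field
  by standard (simp add: power2_eq_square)

instance complex :: rc_field
proof
  fix x :: complex
  show "x * conjugate x = (norm x)\<^sup>2 *\<^sub>R 1"
    using complex_norm_square[of x]
    by (simp only: conjugate_complex_def scaleR_conv_of_real mult_1_right)
qed

lemma conjugate_of_real: "conjugate (of_real r) = (of_real r :: 'a::rc_field)"
proof (cases "r = 0")
  case False
  have "of_real r * conjugate (of_real r) = of_real r * (of_real r :: 'a)"
    using mult_conjugate[of "of_real r :: 'a"] by (simp add: power2_eq_square scaleR_conv_of_real)
  then show ?thesis using False by simp
qed simp

lemma conjugate_one: "conjugate 1 = (1 :: 'a::rc_field)"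
  using conjugate_of_real[of 1, where 'a='a] by simp

lemma norm_conjugate: "norm (conjugate x) = norm (x :: 'a::rc_field)"
proof (cases "x = 0")
  case False
  have "norm x * norm (conjugate x) = norm x * norm x"
    using mult_conjugate[of x] by (metis norm_mult norm_scaleR norm_one mult_1_right
        abs_power2 power2_eq_square)
  then show ?thesis using False by simp
qed simp

subsection \<open>Adjoints and triangular matrices\<close>

lemma index_mult_mat_sum:
  assumes "A \<in> carrier_mat n m" "B \<in> carrier_mat m p" "i < n" "j < p"
  shows "(A * B) $$ (i, j) = (\<Sum>k<m. A $$ (i, k) * B $$ (k, j))"
  using assms by (auto simp: scalar_prod_def atLeast0LessThan intro!: sum.cong)

lemma index_mat_adjoint:
  assumes "A \<in> carrier_mat n m" "i < m" "j < n"
  shows "mat_adjoint A $$ (i, j) = conjugate (A $$ (j, i))"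
  using assms by (auto simp: mat_adjoint_def mat_of_rows_def)

lemma mat_adjoint_carrier: "A \<in> carrier_mat n m \<Longrightarrow> mat_adjoint A \<in> carrier_mat m n"
  by (auto simp: mat_adjoint_def mat_of_rows_def)

lemma mat_adjoint_mult:
  fixes A B :: "'a::rc_field mat"
  assumes A: "A \<in> carrier_mat n m" and B: "B \<in> carrier_mat m p"
  shows "mat_adjoint (A * B) = mat_adjoint B * mat_adjoint A"
proof (rule eq_matI)
  note C = mult_carrier_mat[OF A B]
  note C' = mult_carrier_mat[OF mat_adjoint_carrier[OF B] mat_adjoint_carrier[OF A]]
  show "dim_row (mat_adjoint (A * B)) = dim_row (mat_adjoint B * mat_adjoint A)"
    "dim_col (mat_adjoint (A * B)) = dim_col (mat_adjoint B * mat_adjoint A)"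
    using C' mat_adjoint_carrier[OF C] by auto
  fix i j assume "i < dim_row (mat_adjoint B * mat_adjoint A)" "j < dim_col (mat_adjoint B * mat_adjoint A)"
  then have ij: "i < p" "j < n" using C' by auto
  have "mat_adjoint (A * B) $$ (i, j) = (\<Sum>k<m. conjugate (A $$ (j, k)) * conjugate (B $$ (k, i)))"
    using ij by (simp add: index_mat_adjoint[OF C] index_mult_mat_sum[OF A B] sum_conjugate
        conjugate_dist_mul)
  also have "\<dots> = (\<Sum>k<m. mat_adjoint B $$ (i, k) * mat_adjoint A $$ (k, j))"
    using ij by (intro sum.cong) (auto simp: index_mat_adjoint[OF A] index_mat_adjoint[OF B] mult.commute)
  also have "\<dots> = (mat_adjoint B * mat_adjoint A) $$ (i, j)"
    using ij by (subst index_mult_mat_sum[OF mat_adjoint_carrier[OF B] mat_adjoint_carrier[OF A]]) auto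
  finally show "mat_adjoint (A * B) $$ (i, j) = (mat_adjoint B * mat_adjoint A) $$ (i, j)" .
qed

lemma index_mult_adjoint:
  assumes "A \<in> carrier_mat n m" "B \<in> carrier_mat p m" "i < n" "j < p"
  shows "(A * mat_adjoint B) $$ (i, j) = (\<Sum>k<m. A $$ (i, k) * conjugate (B $$ (j, k)))"
  using assms by (subst index_mult_mat_sum[OF assms(1) mat_adjoint_carrier[OF assms(2)]])
    (auto simp: index_mat_adjoint intro!: sum.cong)

lemma gram_mult:
  fixes A B :: "'a::rc_field mat"
  assumes A: "A \<in> carrier_mat n n" and B: "B \<in> carrier_mat n n"
  shows "(A * B) * mat_adjoint (A * B) = A * (B * mat_adjoint B) * mat_adjoint A"
  using mat_adjoint_carrier[OF A] mat_adjoint_carrier[OF B] A B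
  by (simp add: mat_adjoint_mult[OF A B] assoc_mult_mat[of _ n n _ n _ n])

definition lower_triangular :: "'a::zero mat \<Rightarrow> bool" where
  "lower_triangular A \<longleftrightarrow> (\<forall>i<dim_row A. \<forall>j<dim_col A. i < j \<longrightarrow> A $$ (i, j) = 0)"

lemma lower_triangularD:
  "lower_triangular A \<Longrightarrow> A \<in> carrier_mat n m \<Longrightarrow> i < j \<Longrightarrow> i < n \<Longrightarrow> j < m \<Longrightarrow> A $$ (i, j) = 0"
  by (auto simp: lower_triangular_def)

lemma prod_list_diag_mat: "A \<in> carrier_mat n n \<Longrightarrow> prod_list (diag_mat A) = (\<Prod>i<n. A $$ (i, i))"
  unfolding diag_mat_def
  by (subst prod.distinct_set_conv_list[symmetric]) (auto simp: atLeast0LessThan)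

lemma det_lower:
  fixes A :: "'a::idom mat"
  assumes A: "A \<in> carrier_mat n n" and "lower_triangular A"
  shows "Determinant.det A = (\<Prod>i<n. A $$ (i, i))"
  using assms by (subst det_lower_triangular[OF _ A]) (auto simp: prod_list_diag_mat lower_triangular_def)

lemma det_mat_adjoint:
  fixes A :: "'a::rc_field mat"
  assumes A: "A \<in> carrier_mat n n"
  shows "Determinant.det (mat_adjoint A) = conjugate (Determinant.det A)"
proof -
  interpret comm_ring_hom "conjugate :: 'a \<Rightarrow> 'a"
    by standard (auto simp: conjugate_dist_add conjugate_dist_mul conjugate_one)
  have "mat_adjoint A = transpose_mat (map_mat conjugate A)"
    using A mat_adjoint_carrier[OF A] by (intro eq_matI) (auto simp: index_mat_adjoint[OF A])
  then show ?thesis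
    using A by (simp add: det_transpose[of _ n])
qed

lemma lower_triangular_mult:
  fixes A B :: "'a::comm_ring_1 mat"
  assumes A: "A \<in> carrier_mat n n" and B: "B \<in> carrier_mat n n"
    and l: "lower_triangular A" "lower_triangular B"
  shows "lower_triangular (A * B)"
    and "i < n \<Longrightarrow> (A * B) $$ (i, i) = A $$ (i, i) * B $$ (i, i)"
proof -
  have z: "A $$ (i, k) * B $$ (k, j) = 0" if "i < n" "j < n" "k < n" "i < k \<or> k < j" for i j k
    using that lower_triangularD[OF l(1) A] lower_triangularD[OF l(2) B] by auto
  have "(A * B) $$ (i, j) = 0" if "i < j" "i < n" "j < n" for i j
    using that by (subst index_mult_mat_sum[OF A B]) (auto intro!: sum.neutral z)
  then show "lower_triangular (A * B)" using A B by (auto simp: lower_triangular_def)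
  assume i: "i < n"
  have "(\<Sum>k<n. A $$ (i, k) * B $$ (k, i)) = (\<Sum>k\<in>{i}. A $$ (i, k) * B $$ (k, i))"
    using i by (intro sum.mono_neutral_right) (auto intro!: z)
  then show "(A * B) $$ (i, i) = A $$ (i, i) * B $$ (i, i)"
    using i by (simp add: index_mult_mat_sum[OF A B])
qed

subsection \<open>Leading minors of the Gram matrix\<close>

text \<open>The determinant takes its value in the field. For j up to the size of \<open>v\<close>
  it is a nonnegative real, so \<open>norm\<close> only changes its type.\<close>

definition gram_minor :: "nat \<Rightarrow> 'a::rc_field mat \<Rightarrow> real" where
  "gram_minor j v = norm (Determinant.det (Matrix.mat j j (\<lambda>p. (v * mat_adjoint v) $$ p)))"

text \<open>The first j rows of \<open>L\<close> vanish beyond column j, so the leading block of the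
  Gram matrix of \<open>L\<close> is the Gram matrix of the leading block of \<open>L\<close>. Its
  determinant is the squared norm of a triangular determinant.\<close>

lemma gram_minor_lower:
  fixes L :: "'a::rc_field mat"
  assumes L: "L \<in> carrier_mat n n" and l: "lower_triangular L" and j: "j \<le> n"
  shows "gram_minor j L = (\<Prod>i<j. (norm (L $$ (i, i)))\<^sup>2)"
proof -
  let ?P = "Matrix.mat j j (\<lambda>p. L $$ p)"
  have P: "?P \<in> carrier_mat j j" by simp
  have lP: "lower_triangular ?P"
    using j lower_triangularD[OF l L] by (auto simp: lower_triangular_def)
  have "Matrix.mat j j (\<lambda>p. (L * mat_adjoint L) $$ p) = ?P * mat_adjoint ?P"
  proof (rule eq_matI)
    fix a b assume "a < dim_row (?P * mat_adjoint ?P)" "b < dim_col (?P * mat_adjoint ?P)"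
    then have ab: "a < j" "b < j" using mat_adjoint_carrier[OF P] by auto
    have "(\<Sum>k<n. L $$ (a, k) * conjugate (L $$ (b, k))) = (\<Sum>k<j. L $$ (a, k) * conjugate (L $$ (b, k)))"
      using ab j lower_triangularD[OF l L] by (intro sum.mono_neutral_right) auto
    also have "\<dots> = (\<Sum>k<j. ?P $$ (a, k) * conjugate (?P $$ (b, k)))"
      using ab by (intro sum.cong) auto
    finally show "Matrix.mat j j (\<lambda>p. (L * mat_adjoint L) $$ p) $$ (a, b) = (?P * mat_adjoint ?P) $$ (a, b)"
      using ab j by (simp add: index_mult_adjoint[OF L L] index_mult_adjoint[OF P P] del: index_mult_mat)
  qed (use mat_adjoint_carrier[OF P] in auto)
  then have "gram_minor j L = norm (Determinant.det ?P * Determinant.det (mat_adjoint ?P))"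
    by (simp add: gram_minor_def det_mult[OF P mat_adjoint_carrier[OF P]])
  also have "\<dots> = (\<Prod>i<j. (norm (L $$ (i, i)))\<^sup>2)"
    by (simp add: det_lower[OF P lP] det_mat_adjoint[OF P] norm_mult norm_conjugate
        prod_norm[symmetric] power2_eq_square prod.distrib)
  finally show ?thesis .
qed

subsection \<open>The Iwasawa decomposition\<close>

lemma gram_mult_K:
  fixes A :: "'a::rc_field mat"
  assumes A: "A \<in> carrier_mat n n" and k: "k \<in> K_grp n"
  shows "(A * k) * mat_adjoint (A * k) = A * mat_adjoint A"
  using k gram_mult[OF A, of k] A by (auto simp: K_grp_def SL_grp_def)

lemma Nbar_grpD:
  assumes "b \<in> Nbar_grp n"
  shows "b \<in> carrier_mat n n" "lower_triangular b" "i < n \<Longrightarrow> b $$ (i, i) = 1"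
  using assms by (auto simp: Nbar_grp_def N_grp_def SL_grp_def lower_triangular_def upper_triangular_def)

lemma A_grpD:
  assumes "a \<in> A_grp n"
  shows "a \<in> carrier_mat n n" "lower_triangular a"
    "i < n \<Longrightarrow> j < n \<Longrightarrow> i \<noteq> j \<Longrightarrow> a $$ (i, j) = 0"
  using assms by (auto simp: A_grp_def SL_grp_def lower_triangular_def diagonal_mat_def)

lemma A_grp_diag:
  fixes a :: "'a::rc_field mat"
  assumes "a \<in> A_grp n" "i < n"
  shows "a $$ (i, i) = of_real (norm (a $$ (i, i)))" "norm (a $$ (i, i)) > 0"
proof -
  obtain r where "r > 0" "a $$ (i, i) = of_real r" using assms by (auto simp: A_grp_def)
  then show "a $$ (i, i) = of_real (norm (a $$ (i, i)))" "norm (a $$ (i, i)) > 0" by auto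
qed

text \<open>The unitary factor cancels in the Gram matrix, and the unipotent factor leaves the
  diagonal of the triangular product unchanged. Hence the minors of a group element see only its
  A-component.\<close>

lemma gram_minor_iwasawa:
  fixes a :: "'a::rc_field mat"
  assumes a: "a \<in> A_grp n" and b: "b \<in> Nbar_grp n" and k: "k \<in> K_grp n" and j: "j \<le> n"
  shows "gram_minor j (b * a * k) = (\<Prod>i<j. (norm (a $$ (i, i)))\<^sup>2)"
proof -
  note ba = mult_carrier_mat[OF Nbar_grpD(1)[OF b] A_grpD(1)[OF a]]
  have "gram_minor j (b * a * k) = gram_minor j (b * a)"
    by (simp add: gram_minor_def gram_mult_K[OF ba k])
  also have "\<dots> = (\<Prod>i<j. (norm ((b * a) $$ (i, i)))\<^sup>2)"
    using j A_grpD[OF a] Nbar_grpD[OF b]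
    by (intro gram_minor_lower[OF ba _ j] lower_triangular_mult(1)[of _ n])
  also have "\<dots> = (\<Prod>i<j. (norm (a $$ (i, i)))\<^sup>2)"
    using j A_grpD[OF a] Nbar_grpD[OF b]
    by (intro prod.cong) (auto simp: lower_triangular_mult(2)[of _ n] simp del: index_mult_mat)
  finally show ?thesis .
qed

text \<open>Quotients of consecutive leading products recover the norms of the diagonal entries, and
  these entries are positive reals.\<close>

lemma A_grp_eqI:
  fixes a :: "'a::rc_field mat"
  assumes a: "a \<in> A_grp n" "a' \<in> A_grp n"
    and eq: "\<And>j. j \<le> n \<Longrightarrow> (\<Prod>i<j. (norm (a $$ (i, i)))\<^sup>2) = (\<Prod>i<j. (norm (a' $$ (i, i)))\<^sup>2)"
  shows "a = a'"
proof -
  have diag: "a $$ (j, j) = a' $$ (j, j)" if j: "j < n" for j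
  proof -
    let ?P = "\<lambda>a j. \<Prod>i<j. (norm (a $$ (i, i)))\<^sup>2 :: real"
    have "?P a j > 0"
      using j A_grp_diag(2)[OF a(1)] by (intro prod_pos) auto
    then have nz: "?P a j \<noteq> 0" by (rule less_imp_neq[THEN not_sym])
    have "?P a j * (norm (a $$ (j, j)))\<^sup>2 = ?P a j * (norm (a' $$ (j, j)))\<^sup>2"
      using eq[OF Suc_leI[OF j]] eq[OF less_imp_le[OF j]] by (simp only: prod.lessThan_Suc)
    then have "(norm (a $$ (j, j)))\<^sup>2 = (norm (a' $$ (j, j)))\<^sup>2"
      by (rule mult_left_cancel[OF nz, THEN iffD1])
    then have "norm (a $$ (j, j)) = norm (a' $$ (j, j))" by simp
    then have "(of_real (norm (a $$ (j, j))) :: 'a) = of_real (norm (a' $$ (j, j)))" by simp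
    then show ?thesis
      by (simp only: A_grp_diag(1)[OF a(1) j, symmetric] A_grp_diag(1)[OF a(2) j, symmetric])
  qed
  show ?thesis
  proof (rule eq_matI)
    fix i j assume "i < dim_row a'" "j < dim_col a'"
    then have "i < n" "j < n" using A_grpD(1)[OF a(2)] by auto
    then show "a $$ (i, j) = a' $$ (i, j)"
      using diag A_grpD(3)[OF a(1)] A_grpD(3)[OF a(2)] by (cases "i = j") auto
  qed (use A_grpD(1)[OF a(1)] A_grpD(1)[OF a(2)] in auto)
qed

text \<open>The Gram minors of the product determine its A-component, so any exhibited decomposition
  evaluates the definite description.\<close>

lemma iwasawa_a_eqI:
  fixes a :: "'a::rc_field mat"
  assumes "a \<in> A_grp n" "b \<in> Nbar_grp n" "k \<in> K_grp n"
  shows "iwasawa_a n (b * a * k) = a"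
  unfolding iwasawa_a_def
proof (rule the_equality)
  show "a \<in> A_grp n \<and> (\<exists>nbar\<in>Nbar_grp n. \<exists>k'\<in>K_grp n. b * a * k = nbar * a * k')"
    using assms by blast
next
  fix a' assume "a' \<in> A_grp n \<and> (\<exists>nbar\<in>Nbar_grp n. \<exists>k'\<in>K_grp n. b * a * k = nbar * a' * k')"
  then obtain b' k' where *: "a' \<in> A_grp n" "b' \<in> Nbar_grp n" "k' \<in> K_grp n" "b * a * k = b' * a' * k'"
    by blast
  show "a' = a"
  proof (rule A_grp_eqI[OF *(1) assms(1)])
    fix j assume "j \<le> n"
    then show "(\<Prod>i<j. (norm (a' $$ (i, i)))\<^sup>2) = (\<Prod>i<j. (norm (a $$ (i, i)))\<^sup>2)"
      using gram_minor_iwasawa[OF *(1-3)] gram_minor_iwasawa[OF assms] *(4) by simp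
  qed
qed

lemma mat_adjoint_one: "mat_adjoint (1\<^sub>m n) = (1\<^sub>m n :: 'a::rc_field mat)"
  using mat_adjoint_carrier[of "1\<^sub>m n :: 'a mat" n n]
  by (intro eq_matI) (auto simp: index_mat_adjoint[of "1\<^sub>m n" n n] conjugate_one)

text \<open>A Cholesky factor \<open>L\<close> of \<open>v v\<^sup>*\<close> gives the decomposition \<open>v = (L a\<^sup>-\<^sup>1) a (L\<^sup>-\<^sup>1 v)\<close>.\<close>

lemma iwasawa_a_cholesky:
  fixes v L :: "'a::rc_field mat"
  assumes v: "v \<in> SL_grp n" and L: "L \<in> carrier_mat n n" and l: "lower_triangular L"
    and r: "\<And>i. i < n \<Longrightarrow> r i > 0" "\<And>i. i < n \<Longrightarrow> L $$ (i, i) = of_real (r i)"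
    and eq: "L * mat_adjoint L = v * mat_adjoint v"
  shows "iwasawa_a n v \<in> A_grp n" "i < n \<Longrightarrow> iwasawa_a n v $$ (i, i) = of_real (r i)"
proof -
  have vc: "v \<in> carrier_mat n n" and dv: "Determinant.det v = 1" using v by (auto simp: SL_grp_def)
  note L' = mat_adjoint_carrier[OF L] and vc' = mat_adjoint_carrier[OF vc]
  have dL: "Determinant.det L = of_real (\<Prod>i<n. r i)"
    by (simp add: det_lower[OF L l] r(2))
  have p: "(\<Prod>i<n. r i) > 0" using r(1) by (intro prod_pos) auto
  \<comment> \<open>Equal Gram matrices give |det L| = |det v| = 1. The diagonal of \<open>L\<close>
    is positive, so det L itself is 1, and \<open>a\<close> and \<open>k\<close> get determinant
    1.\<close>
  have "Determinant.det L * Determinant.det (mat_adjoint L) = Determinant.det v * Determinant.det (mat_adjoint v)"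
    using eq det_mult[OF L L'] det_mult[OF vc vc'] by simp
  then have "of_real ((\<Prod>i<n. r i)\<^sup>2) = (1::'a)"
    by (simp only: det_mat_adjoint[OF L] det_mat_adjoint[OF vc] dL dv conjugate_one conjugate_of_real
        power2_eq_square of_real_mult mult_1_left)
  then have "(\<Prod>i<n. r i)\<^sup>2 = 1" by (metis of_real_eq_1_iff)
  then have p1: "(\<Prod>i<n. r i) = 1" using p by (simp add: power2_eq_1_iff)
  then have dL1: "Determinant.det L = 1" using dL by simp

  define a :: "'a mat" where "a = Matrix.mat n n (\<lambda>(i, j). if i = j then of_real (r i) else 0)"
  define c :: "'a mat" where "c = Matrix.mat n n (\<lambda>(i, j). if i = j then of_real (inverse (r i)) else 0)"
  have ac: "a \<in> carrier_mat n n" "c \<in> carrier_mat n n" "lower_triangular a" "lower_triangular c"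
    by (auto simp: a_def c_def lower_triangular_def)
  have "Determinant.det a = of_real (\<Prod>i<n. r i)" unfolding det_lower[OF ac(1,3)] by (simp add: a_def)
  then have aA: "a \<in> A_grp n"
    using ac r p1 by (auto simp: A_grp_def SL_grp_def diagonal_mat_def a_def)
  have ca: "c * a = 1\<^sub>m n"
  proof (rule eq_matI)
    fix i j assume "i < dim_row (1\<^sub>m n)" "j < dim_col (1\<^sub>m n)"
    then have ij: "i < n" "j < n" by auto
    have "(c * a) $$ (i, j) = (\<Sum>k<n. if k = i then (if i = j then of_real (inverse (r i) * r i) else 0) else 0)"
      using ij unfolding index_mult_mat_sum[OF ac(2,1) ij] by (intro sum.cong) (auto simp: a_def c_def)
    then show "(c * a) $$ (i, j) = (1\<^sub>m n :: 'a mat) $$ (i, j)"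
      using ij r(1)[of i] by auto
  qed (use ac in auto)
  define b where "b = L * c"
  have bc: "b \<in> carrier_mat n n" using L ac by (simp add: b_def)
  have bl: "lower_triangular b" unfolding b_def by (rule lower_triangular_mult(1)[OF L ac(2) l ac(4)])
  have bd: "b $$ (i, i) = 1" if "i < n" for i
    unfolding b_def using lower_triangular_mult(2)[OF L ac(2) l ac(4) that] r(1)[OF that] r(2)[OF that] that
    by (simp add: c_def)
  have db: "Determinant.det b = 1" using bd by (simp add: det_lower[OF bc bl])
  have "transpose_mat b \<in> N_grp n"
    using bc bl bd db by (auto simp: N_grp_def SL_grp_def upper_triangular_def lower_triangular_def det_transpose)
  then have bN: "b \<in> Nbar_grp n"
    unfolding Nbar_grp_def by (metis imageI Matrix.transpose_transpose)
  have ba: "b * a = L" using L ac ca by (simp add: b_def assoc_mult_mat[of _ n n _ n _ n])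

  have "L \<in> Units (ring_mat TYPE('a) n undefined)"
    using dL1 by (intro det_non_zero_imp_unit[OF L]) auto
  then obtain B where B: "B \<in> carrier_mat n n" "B * L = 1\<^sub>m n" "L * B = 1\<^sub>m n"
    by (auto simp: Units_def ring_mat_def)
  define k where "k = B * v"
  have kc: "k \<in> carrier_mat n n" using B vc by (simp add: k_def)
  have "Determinant.det L * Determinant.det B = 1"
    using det_mult[OF L B(1)] B(3) by simp
  then have "Determinant.det k = 1" using dL1 dv by (simp add: k_def det_mult[OF B(1) vc])
  \<comment> \<open>Unitarity of \<open>k\<close>: the Gram matrix of \<open>v\<close> inside that
    of \<open>B * v\<close> is exchanged for the Gram matrix of \<open>L\<close>, which leaves the
    Gram matrix of \<open>B * L\<close>, the identity.\<close>
  moreover have "k * mat_adjoint k = B * (L * mat_adjoint L) * mat_adjoint B"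
    unfolding k_def eq by (rule gram_mult[OF B(1) vc])
  then have "k * mat_adjoint k = (B * L) * mat_adjoint (B * L)"
    by (simp only: gram_mult[OF B(1) L])
  then have "k * mat_adjoint k = 1\<^sub>m n * mat_adjoint (1\<^sub>m n)" using B by simp
  then have "k * mat_adjoint k = 1\<^sub>m n"
    by (simp add: mat_adjoint_one)
  ultimately have kK: "k \<in> K_grp n" using kc by (simp add: K_grp_def SL_grp_def)
  have "v = b * a * k"
    using B L vc by (simp add: ba k_def assoc_mult_mat[symmetric, of _ n n _ n _ n])
  then have "iwasawa_a n v = a" using iwasawa_a_eqI[OF aA bN kK] by simp
  then show "iwasawa_a n v \<in> A_grp n" "i < n \<Longrightarrow> iwasawa_a n v $$ (i, i) = of_real (r i)"
    using aA by (auto simp: a_def)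
qed

subsection \<open>The weight of the Iwasawa component\<close>

lemma Ad_A_grp:
  fixes a X :: "'a::rc_field mat"
  assumes a: "a \<in> A_grp n" and X: "X \<in> carrier_mat n n" and ij: "i < n" "j < n"
  shows "Ad a X $$ (i, j) = (norm (a $$ (i, i)) / norm (a $$ (j, j))) *\<^sub>R X $$ (i, j)"
proof -
  note ac = A_grpD(1)[OF a]
  have "Determinant.det a \<noteq> 0" using a by (simp add: A_grp_def SL_grp_def)
  then have "mat_inverse a \<noteq> None"
    using mat_inverse(1)[OF ac, of undefined] det_non_zero_imp_unit[OF ac, of undefined] by blast
  then obtain c where c: "mat_inverse a = Some c" by blast
  then have c': "a * c = 1\<^sub>m n" "c \<in> carrier_mat n n" using mat_inverse(2)[OF ac c] by auto
  have ck: "c $$ (k, j) = (if k = j then inverse (a $$ (j, j)) else 0)" if k: "k < n" for k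
  proof -
    have "(a * c) $$ (k, j) = (\<Sum>l<n. if l = k then a $$ (k, k) * c $$ (k, j) else 0)"
      using k ij A_grpD(3)[OF a k] unfolding index_mult_mat_sum[OF ac c'(2) k ij(2)]
      by (intro sum.cong) auto
    then have "a $$ (k, k) * c $$ (k, j) = (if k = j then 1 else 0)"
      using k ij c' by (simp del: index_mult_mat)
    moreover have "a $$ (k, k) \<noteq> 0" using A_grp_diag[OF a k] by auto
    ultimately show ?thesis by (auto simp: field_simps)
  qed
  have aX: "(a * X) $$ (i, k) = a $$ (i, i) * X $$ (i, k)" if k: "k < n" for k
  proof -
    have "(a * X) $$ (i, k) = (\<Sum>l<n. if l = i then a $$ (i, i) * X $$ (i, k) else 0)"
      using k ij A_grpD(3)[OF a ij(1)] unfolding index_mult_mat_sum[OF ac X ij(1) k]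
      by (intro sum.cong) auto
    then show ?thesis using ij by simp
  qed
  have "Ad a X $$ (i, j) = (\<Sum>k<n. if k = j then a $$ (i, i) * X $$ (i, j) * inverse (a $$ (j, j)) else 0)"
    unfolding Ad_def c option.sel index_mult_mat_sum[OF mult_carrier_mat[OF ac X] c'(2) ij]
    using aX ck by (intro sum.cong) auto
  also have "\<dots> = a $$ (i, i) * X $$ (i, j) * inverse (a $$ (j, j))"
    using ij by simp
  also have "\<dots> = of_real (norm (a $$ (i, i))) * X $$ (i, j) * inverse (of_real (norm (a $$ (j, j))))"
    by (simp only: A_grp_diag(1)[OF a ij(1), symmetric] A_grp_diag(1)[OF a ij(2), symmetric])
  also have "\<dots> = (norm (a $$ (i, i)) / norm (a $$ (j, j))) *\<^sub>R X $$ (i, j)"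
    by (simp add: scaleR_conv_of_real divide_inverse)
  finally show ?thesis .
qed

lemma finite_lie_N_index: "finite {(i, j::nat, b::'a::euclidean_space). i < j \<and> j < n \<and> b \<in> Basis}"
  by (rule finite_subset[of _ "{..<n} \<times> {..<n} \<times> Basis"]) (auto intro!: finite_cartesian_product)

lemma lie_N_index:
  "distinct (lie_N_index n :: (nat \<times> nat \<times> 'a::euclidean_space) list)"
  "set (lie_N_index n :: (nat \<times> nat \<times> 'a) list) = {(i, j, b). i < j \<and> j < n \<and> b \<in> Basis}"
proof -
  have "\<exists>xs. distinct xs \<and> set xs = {(i, j, b::'a). i < j \<and> j < n \<and> b \<in> Basis}"
    using finite_distinct_list[OF finite_lie_N_index[of n]] by blast
  note * = someI_ex[OF this, folded lie_N_index_def]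
  show "distinct (lie_N_index n :: (nat \<times> nat \<times> 'a) list)"
    by (rule conjunct1[OF *])
  show "set (lie_N_index n :: (nat \<times> nat \<times> 'a) list) = {(i, j, b). i < j \<and> j < n \<and> b \<in> Basis}"
    by (rule conjunct2[OF *])
qed

text \<open>In the chosen real basis \<open>Ad a\<close> is diagonal, since it multiplies the entry
  at (i, j) by a real number. Each ratio therefore occurs once for every real basis vector of F,
  whence the exponent.\<close>

lemma lie_N_det_Ad:
  fixes a :: "'a::rc_field mat"
  assumes a: "a \<in> A_grp n"
  shows "lie_N_det n (Ad a) =
    (\<Prod>j<n. \<Prod>i<j. norm (a $$ (i, i)) / norm (a $$ (j, j))) ^ DIM('a)"
proof -
  define xs :: "(nat \<times> nat \<times> 'a) list" where "xs = lie_N_index n"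
  define m where "m = length xs"
  define q where "q = (\<lambda>(i, j, b::'a). norm (a $$ (i, i)) / norm (a $$ (j, j)))"
  have xs: "distinct xs" "set xs = {(i, j, b). i < j \<and> j < n \<and> b \<in> Basis}"
    using lie_N_index unfolding xs_def by blast+
  define M where "M = Matrix.mat m m (\<lambda>(r, c). lie_N_coord (xs ! r) (Ad a (lie_N_elem n (xs ! c))))"
  have M: "M $$ (r, c) = (if r = c then q (xs ! r) else 0)" if rc: "r < m" "c < m" for r c
  proof -
    obtain i j b where r: "xs ! r = (i, j, b)" by (cases "xs ! r")
    obtain i' j' b' where c: "xs ! c = (i', j', b')" by (cases "xs ! c")
    have "xs ! r \<in> set xs" "xs ! c \<in> set xs" using rc by (auto simp: m_def)
    then have *: "i < j" "j < n" "b \<in> Basis" "i' < j'" "j' < n" "b' \<in> Basis"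
      unfolding xs(2) r c by auto
    have E: "lie_N_elem n (i', j', b') \<in> carrier_mat n n" by (simp add: lie_N_elem_def)
    have "r = c \<longleftrightarrow> (i, j, b) = (i', j', b')"
      using rc xs(1) r c unfolding m_def by (metis nth_eq_iff_index_eq)
    moreover have "M $$ (r, c) = q (i, j, b) * inner (lie_N_elem n (i', j', b') $$ (i, j)) b"
      using rc * by (simp add: M_def r c lie_N_coord_def Ad_A_grp[OF a E] q_def)
    moreover have "inner (lie_N_elem n (i', j', b') $$ (i, j)) b = (if (i, j, b) = (i', j', b') then 1 else 0)"
      using * by (auto simp: lie_N_elem_def inner_Basis)
    ultimately show ?thesis by (auto simp: r)
  qed
  have Mc: "M \<in> carrier_mat m m" by (simp add: M_def)
  have Ml: "lower_triangular M" using M Mc by (auto simp: lower_triangular_def)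
  have "lie_N_det n (Ad a) = Determinant.det M"
    by (simp add: lie_N_det_def Let_def M_def m_def xs_def)
  also have "\<dots> = (\<Prod>r<m. q (xs ! r))" using M by (simp add: det_lower[OF Mc Ml])
  \<comment> \<open>From here on only the set of triples matters, so the enumeration picked by
    \<open>SOME\<close> disappears.\<close>
  also have "\<dots> = prod q (set xs)"
    using bij_betw_nth[OF xs(1)] by (intro prod.reindex_bij_betw) (auto simp: m_def)
  also have "\<dots> = (\<Prod>(j, i, b)\<in>(SIGMA j:{..<n}. SIGMA i:{..<j}. Basis). q (i, j, b))"
    unfolding xs(2)
    by (rule prod.reindex_bij_witness[of _ "\<lambda>(j, i, b). (i, j, b)" "\<lambda>(i, j, b). (j, i, b)"]) auto
  also have "\<dots> = (\<Prod>j<n. \<Prod>i<j. \<Prod>b\<in>Basis. q (i, j, b))"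
    by (simp add: prod.Sigma)
  also have "\<dots> = (\<Prod>j<n. \<Prod>i<j. (norm (a $$ (i, i)) / norm (a $$ (j, j))) ^ DIM('a))"
    by (simp add: q_def)
  finally show ?thesis by (simp only: prod_power_distrib)
qed

text \<open>On both sides \<open>r i\<close> has exponent 2 (n - 1 - i). For determinant 1 the power
  of the full product drops out, which turns the product over positive roots into one of squared
  leading products; keeping that power lets the induction run without a constraint on
  \<open>r\<close>.\<close>

lemma prod_ratio_leading:
  fixes r :: "nat \<Rightarrow> real"
  assumes "\<And>i. i < n \<Longrightarrow> r i > 0"
  shows "(\<Prod>j<n. \<Prod>i<j. r i / r j) * (\<Prod>i<n. r i) ^ (n - 1) = (\<Prod>j<n. (\<Prod>i<j. r i)\<^sup>2)"
  using assms
proof (induction n)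
  case (Suc n)
  show ?case
  proof (cases n)
    case 0
    then show ?thesis by simp
  next
    case (Suc k)
    let ?P = "\<Prod>i<n. r i"
    have "(\<Prod>j<Suc n. \<Prod>i<j. r i / r j) * (\<Prod>i<Suc n. r i) ^ (Suc n - 1)
      = (\<Prod>j<n. \<Prod>i<j. r i / r j) * (?P / r n ^ n) * (?P * r n) ^ n"
      by (simp add: prod_dividef)
    \<comment> \<open>The powers of \<open>r n\<close> cancel. Rewriting the remaining power n + 1
      of \<open>?P\<close> as (n - 1) + 2 requires n > 0 because subtraction is truncated, hence the
      case split.\<close>
    also have "\<dots> = ((\<Prod>j<n. \<Prod>i<j. r i / r j) * ?P ^ (n - 1)) * ?P\<^sup>2"
      using Suc.prems[of n] by (simp add: Suc power_mult_distrib power2_eq_square)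
    also have "\<dots> = (\<Prod>j<Suc n. (\<Prod>i<j. r i)\<^sup>2)"
      using Suc.IH Suc.prems by simp
    finally show ?thesis .
  qed
qed simp

lemma rho_pow_A_grp:
  fixes a :: "'a::rc_field mat"
  assumes a: "a \<in> A_grp n"
  shows "rho_pow n a = sqrt ((\<Prod>j<n. \<Prod>i<j. (norm (a $$ (i, i)))\<^sup>2) ^ DIM('a))"
proof -
  have "norm (Determinant.det a) = 1" using a by (simp add: A_grp_def SL_grp_def)
  then have "(\<Prod>i<n. norm (a $$ (i, i))) = 1"
    by (simp add: det_lower[OF A_grpD(1,2)[OF a]] prod_norm)
  then have "(\<Prod>j<n. \<Prod>i<j. norm (a $$ (i, i)) / norm (a $$ (j, j))) = (\<Prod>j<n. \<Prod>i<j. (norm (a $$ (i, i)))\<^sup>2)"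
    using prod_ratio_leading[of n "\<lambda>i. norm (a $$ (i, i))"] A_grp_diag(2)[OF a]
    by (simp only: prod_power_distrib power_one mult_1_right)
  then show ?thesis by (simp add: rho_pow_def lie_N_det_Ad[OF a])
qed

subsection \<open>Cholesky factors of unipotent matrices\<close>

text \<open>The solution y of L y = u for lower triangular \<open>L\<close>. The recursion shows
  that y_j depends only on u_0, ..., u_j and is affine in u_j, which the change of variables
  exploits.\<close>

function forward_subst :: "'a::field mat \<Rightarrow> (nat \<Rightarrow> 'a) \<Rightarrow> nat \<Rightarrow> 'a" where
  "forward_subst L u j = (u j - (\<Sum>i<j. L $$ (j, i) * forward_subst L u i)) / L $$ (j, j)"
  by pat_completeness auto
termination by (relation "Wellfounded.measure (\<lambda>(L, u, j). j)") auto

declare forward_subst.simps[simp del]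

lemma forward_subst_solves:
  assumes L: "L \<in> carrier_mat m m" "lower_triangular L" and j: "j < m" "L $$ (j, j) \<noteq> 0"
  shows "(\<Sum>i<m. L $$ (j, i) * forward_subst L u i) = u j"
proof -
  have "(\<Sum>i<m. L $$ (j, i) * forward_subst L u i) = (\<Sum>i<Suc j. L $$ (j, i) * forward_subst L u i)"
    using j lower_triangularD[OF L(2,1)] by (intro sum.mono_neutral_right) auto
  also have "\<dots> = u j"
    using j by (simp add: forward_subst.simps[of L u j])
  finally show ?thesis .
qed

text \<open>Only Gram matrices are compared, so no unitary factor has to be carried through the
  induction on the size. The diagonal is recorded as a real function because the minors are products
  of its squares.\<close>

definition cholesky :: "nat \<Rightarrow> 'a::rc_field mat \<Rightarrow> 'a mat \<Rightarrow> (nat \<Rightarrow> real) \<Rightarrow> bool" where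
  "cholesky n v L r \<longleftrightarrow> L \<in> carrier_mat n n \<and> lower_triangular L \<and>
     (\<forall>i<n. r i > 0 \<and> L $$ (i, i) = of_real (r i)) \<and> L * mat_adjoint L = v * mat_adjoint v"

lemma gram_minor_cholesky:
  assumes "cholesky n v L r" "j \<le> n"
  shows "gram_minor j v = (\<Prod>i<j. (r i)\<^sup>2)"
proof -
  have "gram_minor j v = gram_minor j L"
    using assms(1) by (simp add: cholesky_def gram_minor_def)
  also have "\<dots> = (\<Prod>i<j. (norm (L $$ (i, i)))\<^sup>2)"
    using assms by (intro gram_minor_lower[of _ n]) (auto simp: cholesky_def)
  also have "\<dots> = (\<Prod>i<j. (r i)\<^sup>2)"
    using assms by (intro prod.cong) (auto simp: cholesky_def)
  finally show ?thesis .
qed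

text \<open>The quantity s_j of the overview, with the coordinates of y counted from 0.\<close>

definition partial_norm :: "(nat \<Rightarrow> 'a::real_normed_vector) \<Rightarrow> nat \<Rightarrow> real" where
  "partial_norm y j = 1 + (\<Sum>i<j. (norm (y i))\<^sup>2)"

lemma partial_norm_ge_1: "partial_norm y j \<ge> 1"
  by (simp add: partial_norm_def sum_nonneg)

lemma partial_norm_pos: "partial_norm y j > 0"
  using partial_norm_ge_1[of y j] by linarith

lemma partial_norm_0: "partial_norm y 0 = 1"
  by (simp add: partial_norm_def)

lemma partial_norm_Suc: "partial_norm y (Suc j) = partial_norm y j + (norm (y j))\<^sup>2"
  by (simp add: partial_norm_def)

text \<open>Telescoping: s_(k+1) - s_k = |y_k|^2, so each summand is 1/s_k - 1/s_(k+1). The sum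
  arises as the contribution of the first l columns to an entry of the Gram matrix of
  \<open>update_mat\<close>.\<close>

lemma sum_partial_norm:
  "(\<Sum>k<l. (norm (y k))\<^sup>2 / (partial_norm y k * partial_norm y (Suc k))) = 1 - 1 / partial_norm y l"
proof (induction l)
  case (Suc l)
  have "(norm (y l))\<^sup>2 / (partial_norm y l * partial_norm y (Suc l)) = 1 / partial_norm y l - 1 / partial_norm y (Suc l)"
    using partial_norm_pos[of y l] partial_norm_pos[of y "Suc l"]
    by (simp add: diff_frac_eq partial_norm_Suc)
  then show ?case using Suc.IH by simp
qed (simp add: partial_norm_0)

lemma prod_partial_norm:
  "(\<Prod>i<j. partial_norm y (Suc i) / partial_norm y i) = partial_norm y j"
proof (induction j)
  case (Suc j)
  then show ?case using partial_norm_pos[of y j] by simp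
qed (simp add: partial_norm_0)

text \<open>
  With \<open>z = (y, 1)\<close>, \<open>update_mat m y\<close> is the Cholesky factor of \<open>diag(1, ..., 1, 0) + z z\<^sup>*\<close>,
  the Gram matrix of \<open>last_col_mat m y\<close>; its diagonal is \<open>update_diag m y\<close>.
\<close>

definition update_diag :: "nat \<Rightarrow> (nat \<Rightarrow> 'a::real_normed_vector) \<Rightarrow> nat \<Rightarrow> real" where
  "update_diag m y i =
     (if i < m then sqrt (partial_norm y (Suc i) / partial_norm y i) else 1 / sqrt (partial_norm y m))"

definition update_mat :: "nat \<Rightarrow> (nat \<Rightarrow> 'a::rc_field) \<Rightarrow> 'a mat" where
  "update_mat m y = Matrix.mat (Suc m) (Suc m) (\<lambda>(i, j).
     if i < j then 0 else if i = j then of_real (update_diag m y i)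
     else (if i < m then y i else 1) * conjugate (y j) *
       of_real (1 / sqrt (partial_norm y j * partial_norm y (Suc j))))"

definition last_col_mat :: "nat \<Rightarrow> (nat \<Rightarrow> 'a::rc_field) \<Rightarrow> 'a mat" where
  "last_col_mat m y = Matrix.mat (Suc m) (Suc m) (\<lambda>(i, j).
     if j = m then (if i < m then y i else 1) else if i = j then 1 else 0)"

lemma gram_conjugate:
  fixes A :: "'a::rc_field mat"
  assumes "A \<in> carrier_mat n n" "i < n" "j < n"
  shows "(A * mat_adjoint A) $$ (j, i) = conjugate ((A * mat_adjoint A) $$ (i, j))"
  using assms
  by (simp add: index_mult_adjoint[of _ n n _ n] sum_conjugate conjugate_dist_mul mult.commute
      del: index_mult_mat)

text \<open>For l \<le> i the columns before l contribute z_i conj(z_l) (1 - 1/s_l), and column l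
  supplies the missing 1/s_l together with the diagonal 1 when i = l < m. Later columns vanish in
  row l. The entries above the diagonal follow by Hermitian symmetry.\<close>

lemma update_mat_gram:
  fixes y :: "nat \<Rightarrow> 'a::rc_field"
  shows "update_mat m y * mat_adjoint (update_mat m y) = last_col_mat m y * mat_adjoint (last_col_mat m y)"
proof -
  let ?C = "update_mat m y" and ?E = "last_col_mat m y"
  define z where "z i = (if i < m then y i else 1)" for i
  define s where "s = partial_norm y"
  have C: "?C \<in> carrier_mat (Suc m) (Suc m)" and E: "?E \<in> carrier_mat (Suc m) (Suc m)"
    by (simp_all add: update_mat_def last_col_mat_def)
  have s: "s j > 0" for j by (simp add: s_def partial_norm_pos)
  have E_gram: "(?E * mat_adjoint ?E) $$ (i, l) = (if i = l \<and> i < m then 1 else 0) + z i * conjugate (z l)"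
    if "i \<le> m" "l \<le> m" for i l
  proof -
    have "(\<Sum>k<m. ?E $$ (i, k) * conjugate (?E $$ (l, k))) = (\<Sum>k<m. if k = i then (if i = l then 1 else 0) else 0)"
      using that by (intro sum.cong) (auto simp: last_col_mat_def conjugate_one)
    moreover have "?E $$ (i, m) = z i" "?E $$ (l, m) = z l"
      using that by (auto simp: last_col_mat_def z_def)
    moreover have "(?E * mat_adjoint ?E) $$ (i, l) = (\<Sum>k<Suc m. ?E $$ (i, k) * conjugate (?E $$ (l, k)))"
      using that by (subst index_mult_adjoint[OF E E]) auto
    ultimately show ?thesis by simp
  qed
  have C_gram: "(?C * mat_adjoint ?C) $$ (i, l) = (if i = l \<and> i < m then 1 else 0) + z i * conjugate (z l)"
    if li: "l \<le> i" "i \<le> m" for i l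
  proof -
    have a: "?C $$ (i, k) * conjugate (?C $$ (l, k)) =
        z i * conjugate (z l) * of_real ((norm (y k))\<^sup>2 / (s k * s (Suc k)))" if k: "k < l" for k
    proof -
      define \<alpha> where "\<alpha> = 1 / sqrt (s k * s (Suc k))"
      have "?C $$ (i, k) = z i * conjugate (y k) * of_real \<alpha>" "?C $$ (l, k) = z l * conjugate (y k) * of_real \<alpha>"
        using k li by (simp_all add: update_mat_def z_def s_def \<alpha>_def)
      then have "?C $$ (i, k) * conjugate (?C $$ (l, k)) =
          z i * conjugate (z l) * (y k * conjugate (y k)) * of_real (\<alpha> * \<alpha>)"
        by (simp add: conjugate_dist_mul conjugate_of_real ac_simps)
      also have "\<alpha> * \<alpha> = 1 / (s k * s (Suc k))"
        using s[of k] s[of "Suc k"] by (simp add: \<alpha>_def)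
      finally show ?thesis by (simp add: mult_conjugate scaleR_conv_of_real)
    qed
    have "(?C * mat_adjoint ?C) $$ (i, l) = (\<Sum>k<Suc m. ?C $$ (i, k) * conjugate (?C $$ (l, k)))"
      using li by (subst index_mult_adjoint[OF C C]) auto
    also have "\<dots> = (\<Sum>k<Suc l. ?C $$ (i, k) * conjugate (?C $$ (l, k)))"
      using li by (intro sum.mono_neutral_right) (auto simp: update_mat_def)
    also have "\<dots> = z i * conjugate (z l) * of_real (1 - 1 / s l) + ?C $$ (i, l) * conjugate (?C $$ (l, l))"
      by (simp add: a sum_distrib_left[symmetric] of_real_sum[symmetric] sum_partial_norm s_def
          del: of_real_sum of_real_divide of_real_diff)
    also have "?C $$ (i, l) * conjugate (?C $$ (l, l)) =
      (if i = l \<and> i < m then 1 else 0) + z i * conjugate (z l) * of_real (1 / s l)"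
    proof (cases "i = l")
      case True
      have "?C $$ (i, l) * conjugate (?C $$ (l, l)) = of_real (update_diag m y l * update_diag m y l)"
        using li True by (simp add: update_mat_def conjugate_of_real)
      \<comment> \<open>For l < m this is s_(l+1)/s_l = 1 + |y_l|^2/s_l; for l = m it is 1/s_m,
        where z_m = 1.\<close>
      also have "update_diag m y l * update_diag m y l = (if l < m then 1 else 0) + (norm (z l))\<^sup>2 * (1 / s l)"
        using s[of l] s[of m] s[of "Suc l"] li True
        by (auto simp: update_diag_def z_def s_def partial_norm_Suc field_simps)
      finally show ?thesis using True
        by (auto simp: mult_conjugate scaleR_conv_of_real)
    next
      case False
      then have l: "l < i" "l < m" using li by auto
      have "?C $$ (i, l) * conjugate (?C $$ (l, l)) =
        z i * conjugate (z l) * of_real (1 / sqrt (s l * s (Suc l)) * sqrt (s (Suc l) / s l))"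
        using l li by (simp add: update_mat_def update_diag_def conjugate_of_real z_def s_def)
      also have "1 / sqrt (s l * s (Suc l)) * sqrt (s (Suc l) / s l) = 1 / s l"
        using s[of l] s[of "Suc l"] by (simp add: real_sqrt_mult real_sqrt_divide)
      finally show ?thesis using False by simp
    qed
    finally show ?thesis by (simp add: algebra_simps)
  qed
  show ?thesis
  proof (rule eq_matI)
    fix i l assume "i < dim_row (?E * mat_adjoint ?E)" "l < dim_col (?E * mat_adjoint ?E)"
    then have il: "i \<le> m" "l \<le> m" using E mat_adjoint_carrier[OF E] by auto
    show "(?C * mat_adjoint ?C) $$ (i, l) = (?E * mat_adjoint ?E) $$ (i, l)"
    proof (cases "l \<le> i")
      case True
      then show ?thesis using il C_gram E_gram by simp
    next
      case False
      then have "(?C * mat_adjoint ?C) $$ (l, i) = (?E * mat_adjoint ?E) $$ (l, i)"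
        using il C_gram E_gram by simp
      then show ?thesis
        using il gram_conjugate[OF C, of l i] gram_conjugate[OF E, of l i] by simp
    qed
  qed (use C E mat_adjoint_carrier[OF C] mat_adjoint_carrier[OF E] in auto)
qed

text \<open>Let D be \<open>L\<close> extended by a diagonal 1. Since L y = u, the matrix D
  \<open>?E\<close> has upper left block \<open>L\<close> and the same last column as the new
  unipotent matrix, whose block is V. As \<open>L\<close> and V share their Gram matrix, so do the
  bordered matrices. Replacing \<open>?E\<close> by its own Cholesky factor \<open>?C\<close> makes
  the product lower triangular without changing its Gram matrix.\<close>

lemma cholesky_step:
  fixes x :: "nat \<times> nat \<Rightarrow> 'a::rc_field"
  assumes ch: "cholesky m (unip m x) L r"
  defines "y \<equiv> forward_subst L (\<lambda>i. x (i, m))"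
  shows "\<exists>L'. cholesky (Suc m) (unip (Suc m) x) L'
           (\<lambda>i. (if i < m then r i else 1) * update_diag m y i)"
proof -
  have L: "L \<in> carrier_mat m m" "lower_triangular L"
    and r: "\<And>i. i < m \<Longrightarrow> r i > 0" "\<And>i. i < m \<Longrightarrow> L $$ (i, i) = of_real (r i)"
    and gram: "L * mat_adjoint L = unip m x * mat_adjoint (unip m x)"
    using ch by (auto simp: cholesky_def)
  let ?C = "update_mat m y" and ?E = "last_col_mat m y" and ?v = "unip (Suc m) x" and ?V = "unip m x"
  define D where "D = Matrix.mat (Suc m) (Suc m) (\<lambda>(i, j).
    if i < m \<and> j < m then L $$ (i, j) else if i = j then 1 else 0)"
  have C: "?C \<in> carrier_mat (Suc m) (Suc m)" and E: "?E \<in> carrier_mat (Suc m) (Suc m)"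
    and D: "D \<in> carrier_mat (Suc m) (Suc m)" and v: "?v \<in> carrier_mat (Suc m) (Suc m)"
    and V: "?V \<in> carrier_mat m m"
    by (simp_all add: update_mat_def last_col_mat_def D_def unip_def)
  have Dl: "lower_triangular D"
    using lower_triangularD[OF L(2,1)] by (auto simp: lower_triangular_def D_def)
  have Cl: "lower_triangular ?C" by (auto simp: lower_triangular_def update_mat_def)
  have DE: "(D * ?E) $$ (i, j) = (if j = m then ?v $$ (i, m) else D $$ (i, j))"
    if ij: "i \<le> m" "j \<le> m" for i j
  proof -
    have "(D * ?E) $$ (i, j) = (\<Sum>k<Suc m. D $$ (i, k) * ?E $$ (k, j))"
      using ij by (subst index_mult_mat_sum[OF D E]) auto
    also have "\<dots> = (if j = m then ?v $$ (i, m) else D $$ (i, j))"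
    proof (cases "j = m")
      case True
      have "(\<Sum>k<m. D $$ (i, k) * ?E $$ (k, m)) = (\<Sum>k<m. if i < m then L $$ (i, k) * y k else 0)"
        using ij by (intro sum.cong) (auto simp: D_def last_col_mat_def)
      also have "\<dots> = (if i < m then x (i, m) else 0)"
        using forward_subst_solves[OF L, of i "\<lambda>i. x (i, m)"] r(1,2)[of i] by (auto simp: y_def)
      finally show ?thesis
        using True ij by (auto simp: D_def last_col_mat_def unip_def)
    next
      case False
      have "(\<Sum>k<m. D $$ (i, k) * ?E $$ (k, j)) = (\<Sum>k<m. if k = j then D $$ (i, j) else 0)"
        using ij False by (intro sum.cong) (auto simp: last_col_mat_def)
      then show ?thesis
        using False ij by (auto simp: last_col_mat_def)
    qed
    finally show ?thesis .
  qed
  have "(D * ?E) * mat_adjoint (D * ?E) = ?v * mat_adjoint ?v"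
  proof (rule eq_matI)
    note DEc = mult_carrier_mat[OF D E]
    fix i j assume "i < dim_row (?v * mat_adjoint ?v)" "j < dim_col (?v * mat_adjoint ?v)"
    then have ij: "i \<le> m" "j \<le> m" using v mat_adjoint_carrier[OF v] by auto
    \<comment> \<open>The two bordered matrices agree in the last column, so it is enough to compare
      the first m columns, where the hypothesis on \<open>L\<close> applies.\<close>
    have *: "(\<Sum>k<m. D $$ (i, k) * conjugate (D $$ (j, k))) = (\<Sum>k<m. ?v $$ (i, k) * conjugate (?v $$ (j, k)))"
    proof (cases "i < m \<and> j < m")
      case True
      have "(\<Sum>k<m. D $$ (i, k) * conjugate (D $$ (j, k))) = (L * mat_adjoint L) $$ (i, j)"
        using True by (subst index_mult_adjoint[OF L(1) L(1)]) (auto simp: D_def intro!: sum.cong)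
      also have "\<dots> = (\<Sum>k<m. ?V $$ (i, k) * conjugate (?V $$ (j, k)))"
        unfolding gram using True by (subst index_mult_adjoint[OF V V]) auto
      also have "\<dots> = (\<Sum>k<m. ?v $$ (i, k) * conjugate (?v $$ (j, k)))"
        using True by (intro sum.cong) (auto simp: unip_def)
      finally show ?thesis .
    next
      case False
      then show ?thesis using ij by (auto simp: D_def unip_def intro!: sum.neutral)
    qed
    have "((D * ?E) * mat_adjoint (D * ?E)) $$ (i, j)
       = (\<Sum>k<Suc m. (D * ?E) $$ (i, k) * conjugate ((D * ?E) $$ (j, k)))"
      using ij by (subst index_mult_adjoint[OF DEc DEc]) auto
    also have "\<dots> = (\<Sum>k<m. D $$ (i, k) * conjugate (D $$ (j, k))) + ?v $$ (i, m) * conjugate (?v $$ (j, m))"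
      using ij by (simp add: DE del: index_mult_mat)
    also have "\<dots> = (?v * mat_adjoint ?v) $$ (i, j)"
      using ij by (simp add: * index_mult_adjoint[OF v v] del: index_mult_mat)
    finally show "((D * ?E) * mat_adjoint (D * ?E)) $$ (i, j) = (?v * mat_adjoint ?v) $$ (i, j)" .
  qed (use D v mat_adjoint_carrier[OF v] mat_adjoint_carrier[OF mult_carrier_mat[OF D E]] in auto)
  then have "(D * ?C) * mat_adjoint (D * ?C) = ?v * mat_adjoint ?v"
    by (simp only: gram_mult[OF D C] gram_mult[OF D E] update_mat_gram)
  moreover have "update_diag m y i > 0" for i
    using partial_norm_pos[of y] by (simp add: update_diag_def)
  moreover have "(D * ?C) $$ (i, i) = of_real ((if i < m then r i else 1) * update_diag m y i)" if "i < Suc m" for i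
    using that r(2)[of i] lower_triangular_mult(2)[OF D C Dl Cl that]
    by (auto simp: D_def update_mat_def)
  ultimately have "cholesky (Suc m) ?v (D * ?C) (\<lambda>i. (if i < m then r i else 1) * update_diag m y i)"
    unfolding cholesky_def
    using mult_carrier_mat[OF D C] lower_triangular_mult(1)[OF D C Dl Cl] r(1) by auto
  then show ?thesis by blast
qed

lemma ex_cholesky_unip:
  fixes x :: "nat \<times> nat \<Rightarrow> 'a::rc_field"
  shows "\<exists>L r. cholesky n (unip n x) L r"
proof (induction n)
  case 0
  have "cholesky 0 (unip 0 x) (unip 0 x) (\<lambda>_. 1)"
    by (simp add: cholesky_def lower_triangular_def unip_def)
  then show ?case by blast
next
  case (Suc m)
  then show ?case using cholesky_step by blast
qed

text \<open>Below index m the squared diagonal of the Cholesky factor is multiplied by s_(i+1)/s_i,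
  and these ratios telescope to s_j.\<close>

lemma gram_minor_step:
  fixes x :: "nat \<times> nat \<Rightarrow> 'a::rc_field"
  assumes ch: "cholesky m (unip m x) L r" and j: "j \<le> m"
  shows "gram_minor j (unip (Suc m) x) =
    gram_minor j (unip m x) * partial_norm (forward_subst L (\<lambda>i. x (i, m))) j"
proof -
  let ?y = "forward_subst L (\<lambda>i. x (i, m))"
  obtain L' where ch': "cholesky (Suc m) (unip (Suc m) x) L' (\<lambda>i. (if i < m then r i else 1) * update_diag m ?y i)"
    using cholesky_step[OF ch] by blast
  have "gram_minor j (unip (Suc m) x) = (\<Prod>i<j. (r i)\<^sup>2 * (partial_norm ?y (Suc i) / partial_norm ?y i))"
    using j partial_norm_pos[of ?y] unfolding gram_minor_cholesky[OF ch' le_SucI[OF j]]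
    by (intro prod.cong) (auto simp: update_diag_def power_mult_distrib less_imp_le)
  then show ?thesis
    by (simp only: prod.distrib prod_partial_norm gram_minor_cholesky[OF ch j])
qed

lemma unip_N_grp: "unip n (x :: nat \<times> nat \<Rightarrow> 'a::{comm_ring_1, euclidean_space}) \<in> N_grp n"
proof -
  \<comment> \<open>\<open>unip\<close> reads only the coordinates in \<open>upper_index n\<close>;
    the restriction to them is extensional and hence a point of the product space.\<close>
  have "unip n x = unip n (\<lambda>p\<in>upper_index n. x p)"
    by (rule eq_matI) (auto simp: unip_def upper_index_def)
  moreover have "unip n (\<lambda>p\<in>upper_index n. x p) \<in> space (haar_N n)"
    unfolding haar_N_def space_embed_measure by (rule imageI) (auto simp: space_PiM)
  ultimately show ?thesis by (simp add: space_haar_N)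
qed

subsection \<open>Integration over one column\<close>

text \<open>An affine substitution with real slope. Its Jacobian is taken over the reals, so the
  scale enters to the power \<open>DIM('a)\<close>.\<close>

lemma nn_integral_lborel_scale:
  fixes c :: "'a::euclidean_space" and f :: "'a \<Rightarrow> ennreal"
  assumes f[measurable]: "f \<in> borel_measurable borel" and r: "r > 0"
  shows "(\<integral>\<^sup>+u. f ((1 / r) *\<^sub>R (u - c)) \<partial>lborel) = ennreal (r ^ DIM('a)) * (\<integral>\<^sup>+u. f u \<partial>lborel)"
proof -
  let ?g = "\<lambda>u. f ((1 / r) *\<^sub>R (u - c))"
  have "(\<integral>\<^sup>+u. ?g u \<partial>lborel) =
      (\<integral>\<^sup>+u. ?g u \<partial>density (distr lborel borel (\<lambda>x. c + r *\<^sub>R x)) (\<lambda>_. \<bar>r\<bar> ^ DIM('a)))"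
    using lborel_affine[of r c] r by simp
  also have "\<dots> = (\<integral>\<^sup>+u. ennreal (r ^ DIM('a)) * f u \<partial>lborel)"
    using r by (simp add: nn_integral_density nn_integral_distr)
  also have "\<dots> = ennreal (r ^ DIM('a)) * (\<integral>\<^sup>+u. f u \<partial>lborel)"
    by (simp add: nn_integral_cmult)
  finally show ?thesis .
qed

lemma forward_subst_cong:
  "(\<And>i. i \<le> j \<Longrightarrow> u i = u' i) \<Longrightarrow> forward_subst L u j = forward_subst L u' j"
proof (induction j rule: less_induct)
  case (less j)
  have "forward_subst L u i = forward_subst L u' i" if "i < j" for i
    using that less.prems by (intro less.IH) auto
  then show ?case
    using less.prems[of j] by (simp add: forward_subst.simps[of L _ j])
qed

lemma measurable_PiM_lborel_component:
  "p \<in> I \<Longrightarrow> (\<lambda>x. x p) \<in> borel_measurable (Pi\<^sub>M I (\<lambda>_. lborel :: 'a::euclidean_space measure))"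
  using measurable_component_singleton[of p I "\<lambda>_. lborel :: 'a measure"] by simp

lemma forward_subst_measurable:
  fixes L :: "'a::rc_field mat"
  assumes "\<And>i. i \<le> j \<Longrightarrow> (i, m) \<in> I"
  shows "(\<lambda>u. forward_subst L (\<lambda>i. u (i, m)) j) \<in> borel_measurable (Pi\<^sub>M I (\<lambda>_. lborel))"
  using assms
proof (induction j rule: less_induct)
  case (less j)
  have [measurable]: "(\<lambda>u. forward_subst L (\<lambda>i. u (i, m)) i) \<in> borel_measurable (Pi\<^sub>M I (\<lambda>_. lborel))"
    if "i < j" for i
    using that less.prems by (intro less.IH) auto
  have [measurable]: "(\<lambda>u. u (j, m)) \<in> borel_measurable (Pi\<^sub>M I (\<lambda>_. lborel :: 'a measure))"
    using less.prems by (intro measurable_PiM_lborel_component) auto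
  show ?case
    unfolding forward_subst.simps[of L _ j] divide_inverse
    by (intro borel_measurable_times borel_measurable_diff borel_measurable_sum) auto
qed

text \<open>The substitution u = L y, carried out one coordinate at a time. For fixed earlier
  coordinates y_k is affine in u_k with slope \<open>1 / r k\<close>, and no y_j with j < k involves
  u_k, so integrating over u_k first splits off one factor and a scalar Jacobian.\<close>

lemma nn_integral_forward_subst:
  fixes L :: "'a::rc_field mat" and g :: "'a \<Rightarrow> ennreal" and m :: 'b
  assumes g[measurable]: "g \<in> borel_measurable borel"
    and r: "\<And>j. j < k \<Longrightarrow> r j > 0" "\<And>j. j < k \<Longrightarrow> L $$ (j, j) = of_real (r j)"
  shows "(\<integral>\<^sup>+u. (\<Prod>j<k. g (forward_subst L (\<lambda>i. u (i, m)) j)) \<partial>Pi\<^sub>M ((\<lambda>i. (i, m)) ` {..<k}) (\<lambda>_. lborel))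
    = (\<Prod>j<k. ennreal (r j ^ DIM('a))) * (\<integral>\<^sup>+y. g y \<partial>lborel) ^ k"
  using r
proof (induction k)
  case 0
  then show ?case by (simp add: PiM_empty nn_integral_count_space_finite)
next
  case (Suc k)
  interpret product_sigma_finite "\<lambda>_ :: nat \<times> 'b. lborel :: 'a measure" by standard
  let ?I = "(\<lambda>i. (i, m)) ` {..<k}"
  let ?y = "\<lambda>u. forward_subst L (\<lambda>i. u (i, m))"
  let ?K = "\<integral>\<^sup>+y. g y \<partial>lborel"
  have ym: "(\<lambda>u. ?y u j) \<in> borel_measurable (Pi\<^sub>M I (\<lambda>_. lborel))"
    if "(\<lambda>i. (i, m)) ` {..j} \<subseteq> I" for I j
    using that by (intro forward_subst_measurable) auto
  have meas: "(\<lambda>u. \<Prod>j<k. g (?y u j)) \<in> borel_measurable (Pi\<^sub>M ?I (\<lambda>_. lborel))"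
    by (intro borel_measurable_prod_ennreal measurable_compose[OF ym g]) auto
  have meas': "(\<lambda>u. \<Prod>j<Suc k. g (?y u j)) \<in> borel_measurable (Pi\<^sub>M (insert (k, m) ?I) (\<lambda>_. lborel))"
    by (intro borel_measurable_prod_ennreal measurable_compose[OF ym g]) (auto simp: less_Suc_eq_le le_less)
  have inner: "(\<integral>\<^sup>+t. (\<Prod>j<Suc k. g (?y (u((k, m) := t)) j)) \<partial>lborel) =
      (\<Prod>j<k. g (?y u j)) * (ennreal (r k ^ DIM('a)) * ?K)" for u
  proof -
    define c where "c = (\<Sum>i<k. L $$ (k, i) * ?y u i)"
    have y1: "?y (u((k, m) := t)) j = ?y u j" if "j < k" for j t
      using that by (intro forward_subst_cong) auto
    have y2: "?y (u((k, m) := t)) k = (1 / r k) *\<^sub>R (t - c)" for t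
    proof -
      have "(\<Sum>i<k. L $$ (k, i) * ?y (u((k, m) := t)) i) = c"
        unfolding c_def by (intro sum.cong refl) (simp only: lessThan_iff y1)
      then have "?y (u((k, m) := t)) k = (t - c) / of_real (r k)"
        using Suc.prems(2)[of k] forward_subst.simps[of L "\<lambda>i. (u((k, m) := t)) (i, m)" k] by simp
      then show ?thesis by (simp add: scaleR_conv_of_real divide_inverse mult.commute)
    qed
    have "(\<integral>\<^sup>+t. (\<Prod>j<Suc k. g (?y (u((k, m) := t)) j)) \<partial>lborel) =
        (\<integral>\<^sup>+t. (\<Prod>j<k. g (?y u j)) * g ((1 / r k) *\<^sub>R (t - c)) \<partial>lborel)"
      unfolding prod.lessThan_Suc y2
      by (intro nn_integral_cong arg_cong2[where f = "(*)"] prod.cong refl) (simp only: lessThan_iff y1)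
    also have "\<dots> = (\<Prod>j<k. g (?y u j)) * (\<integral>\<^sup>+t. g ((1 / r k) *\<^sub>R (t - c)) \<partial>lborel)"
      by (simp add: nn_integral_cmult)
    also have "(\<integral>\<^sup>+t. g ((1 / r k) *\<^sub>R (t - c)) \<partial>lborel) = ennreal (r k ^ DIM('a)) * ?K"
      using Suc.prems(1)[of k] by (intro nn_integral_lborel_scale g) auto
    finally show ?thesis .
  qed
  have ins: "(\<lambda>i. (i, m)) ` {..<Suc k} = insert (k, m) ?I" by (auto simp: lessThan_Suc)
  have "(\<integral>\<^sup>+u. (\<Prod>j<Suc k. g (?y u j)) \<partial>Pi\<^sub>M ((\<lambda>i. (i, m)) ` {..<Suc k}) (\<lambda>_. lborel)) =
      (\<integral>\<^sup>+u. (\<Prod>j<k. g (?y u j)) * (ennreal (r k ^ DIM('a)) * ?K) \<partial>Pi\<^sub>M ?I (\<lambda>_. lborel))"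
    unfolding ins inner[symmetric] by (rule product_nn_integral_insert[OF _ _ meas']) auto
  also have "\<dots> = (\<integral>\<^sup>+u. (\<Prod>j<k. g (?y u j)) \<partial>Pi\<^sub>M ?I (\<lambda>_. lborel)) * (ennreal (r k ^ DIM('a)) * ?K)"
    by (rule nn_integral_multc[OF meas])
  also have "\<dots> = (\<Prod>j<Suc k. ennreal (r j ^ DIM('a))) * ?K ^ Suc k"
    using Suc by (simp add: ac_simps)
  finally show ?case .
qed

subsection \<open>The weight function\<close>

text \<open>For q the product of the minors and d the real dimension of F, the first factor is
  \<open>a\<close> to the power -\<rho>, and d/2 times ln q is \<rho>(log a). The integrand is the
  case p = binomial(n, 2) + \<epsilon>.\<close>

definition weight :: "nat \<Rightarrow> real \<Rightarrow> real \<Rightarrow> real" where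
  "weight d p q = q powr (- (real d / 2)) * (1 + real d / 2 * ln q) powr (- p)"

lemma weight_nonneg: "weight d p q \<ge> 0"
  by (simp add: weight_def)

lemma weight_antimono:
  assumes "1 \<le> q" "q \<le> q'" "p \<ge> 0"
  shows "weight d p q' \<le> weight d p q"
  unfolding weight_def
proof (intro mult_mono)
  show "q' powr (- (real d / 2)) \<le> q powr (- (real d / 2))"
    using assms by (intro powr_mono2') auto
  have "0 \<le> ln q" "ln q \<le> ln q'" using assms by auto
  then show "(1 + real d / 2 * ln q') powr - p \<le> (1 + real d / 2 * ln q) powr - p"
    using assms by (intro powr_mono2' add_left_mono mult_left_mono add_pos_nonneg mult_nonneg_nonneg) auto
qed auto

lemma weight_mult:
  assumes q: "1 \<le> q" "1 \<le> q'" and p: "p \<ge> 0" "p' \<ge> 0"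
  shows "weight d (p + p') (q * q') \<le> weight d p q * weight d p' q'"
proof -
  let ?a = "real d / 2 * ln q" and ?b = "real d / 2 * ln q'"
  have ab: "?a \<ge> 0" "?b \<ge> 0" using q by auto
  have "(1 + (?a + ?b)) powr (- (p + p')) = (1 + (?a + ?b)) powr (- p) * (1 + (?a + ?b)) powr (- p')"
    by (simp add: powr_add[symmetric])
  \<comment> \<open>Drop \<open>?b\<close> in the first factor and \<open>?a\<close> in the second;
    both exponents are nonpositive.\<close>
  also have "\<dots> \<le> (1 + ?a) powr (- p) * (1 + ?b) powr (- p')"
    using ab p by (intro mult_mono powr_mono2') auto
  finally have *: "(1 + (?a + ?b)) powr (- (p + p')) \<le> (1 + ?a) powr (- p) * (1 + ?b) powr (- p')" .
  have "real d / 2 * ln (q * q') = ?a + ?b"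
    using q by (simp add: ln_mult distrib_left)
  then have "weight d (p + p') (q * q') =
      q powr (- (real d / 2)) * q' powr (- (real d / 2)) * (1 + (?a + ?b)) powr (- (p + p'))"
    using q unfolding weight_def by (simp only: powr_mult)
  also have "\<dots> \<le> q powr (- (real d / 2)) * q' powr (- (real d / 2)) * ((1 + ?a) powr (- p) * (1 + ?b) powr (- p'))"
    by (intro mult_left_mono *) auto
  finally show ?thesis by (simp add: weight_def ac_simps)
qed

lemma weight_prod:
  assumes "\<And>i. i < k \<Longrightarrow> q i \<ge> 1" "p \<ge> 0"
  shows "weight d (real k * p) (\<Prod>i<k. q i) \<le> (\<Prod>i<k. weight d p (q i))"
  using assms
proof (induction k)
  case (Suc k)
  have "(\<Prod>i<k. q i) \<ge> 1" using Suc.prems by (intro prod_ge_1) auto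
  then have "weight d (real k * p + p) ((\<Prod>i<k. q i) * q k) \<le> weight d (real k * p) (\<Prod>i<k. q i) * weight d p (q k)"
    using Suc.prems by (intro weight_mult) auto
  also have "\<dots> \<le> (\<Prod>i<k. weight d p (q i)) * weight d p (q k)"
    using Suc by (intro mult_right_mono weight_nonneg) auto
  finally show ?case by (simp add: distrib_right add.commute)
qed (simp add: weight_def)

text \<open>
  On the shell \<open>2\<^sup>k \<le> |y| < 2\<^sup>k\<^sup>+\<^sup>1\<close> the weight cancels the volume up to the factor
  \<open>(1 + d k ln 2)\<^sup>-\<^sup>p\<close>, which is summable for \<open>p > 1\<close>.
\<close>

lemma nn_integral_weight_finite:
  fixes p :: real
  assumes p: "p > 1"
  shows "(\<integral>\<^sup>+y. ennreal (weight DIM('a) p (1 + (norm y)\<^sup>2)) \<partial>(lborel :: 'a::euclidean_space measure)) < \<infinity>"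
proof -
  let ?d = "DIM('a)" and ?V = "unit_ball_vol (real DIM('a))"
  let ?B = "\<lambda>k. ball (0::'a) (2 ^ Suc k)"
  \<comment> \<open>On the k-th shell 1 + |y|^2 is at least 4^k, so \<open>c k\<close> bounds the
    weight there. In \<open>a k\<close> the shell is enlarged to the full ball of radius
    2^(k+1).\<close>
  define c where "c k = weight ?d p (4 ^ k)" for k
  define a where "a k = c k * (?V * (2 ^ Suc k) ^ ?d)" for k
  have bound: "ennreal (weight ?d p (1 + (norm y)\<^sup>2)) \<le> (\<Sum>k. ennreal (c k) * indicator (?B k) y)" for y :: 'a
  proof -
    have ex: "\<exists>k. norm y < 2 ^ Suc k"
      using real_arch_pow[of 2 "norm y"] by (metis less_trans one_less_numeral_iff
          power_strict_increasing_iff lessI semiring_norm(76))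
    \<comment> \<open>Minimality gives |y| \<ge> 2^k when k > 0. For k = 0 the shell is the whole
      ball of radius 2, where 1 + |y|^2 \<ge> 1 suffices.\<close>
    define k where "k = (LEAST k. norm y < 2 ^ Suc k)"
    have k: "norm y < 2 ^ Suc k" unfolding k_def by (rule LeastI_ex[OF ex])
    have "4 ^ k \<le> 1 + (norm y)\<^sup>2"
    proof (cases k)
      case (Suc l)
      have "\<not> norm y < 2 ^ Suc l" using not_less_Least[of l "\<lambda>k. norm y < 2 ^ Suc k"] Suc
        unfolding k_def by auto
      then have "(2 ^ k)\<^sup>2 \<le> (norm y)\<^sup>2" unfolding Suc by (intro power_mono) auto
      moreover have "((2::real) ^ k)\<^sup>2 = 4 ^ k" by (simp add: power2_eq_square flip: power_mult_distrib)
      ultimately show ?thesis by simp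
    qed simp
    then have "weight ?d p (1 + (norm y)\<^sup>2) \<le> c k"
      unfolding c_def using p by (intro weight_antimono) auto
    then have "ennreal (weight ?d p (1 + (norm y)\<^sup>2)) \<le> (\<Sum>k\<in>{k}. ennreal (c k) * indicator (?B k) y)"
      using k by (simp add: ennreal_leI)
    also have "\<dots> \<le> (\<Sum>k. ennreal (c k) * indicator (?B k) y)"
      by (rule sum_le_suminf) auto
    finally show ?thesis .
  qed
  have a_eq: "a k = ?V * 2 ^ ?d * (1 + real ?d * real k * ln 2) powr (- p)" for k
  proof -
    have "((4::real) ^ k) powr (- (real ?d / 2)) = inverse ((2 ^ k) ^ ?d)"
    proof -
      have "((4::real) ^ k) = 2 powr (2 * real k)"
        by (simp add: powr_mult powr_powr[symmetric] powr_realpow)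
      then have "((4::real) ^ k) powr (- (real ?d / 2)) = 2 powr (- (real (k * ?d)))"
        by (simp add: powr_powr)
      also have "\<dots> = inverse (2 ^ (k * ?d))"
        by (simp add: powr_minus powr_realpow del: of_nat_mult)
      finally show ?thesis by (simp add: power_mult)
    qed
    moreover have "real ?d / 2 * ln (4 ^ k) = real ?d * real k * ln 2"
      using ln_realpow[of 2 2] by (simp add: ln_realpow)
    ultimately show ?thesis
      by (simp add: a_def c_def weight_def power_mult_distrib field_simps)
  qed
  have a0: "a k \<ge> 0" for k by (simp add: a_eq)
  \<comment> \<open>The comparison series uses 1 + d k ln 2 \<ge> (k + 1)/2, which holds because d
    ln 2 \<ge> 1/2; the halving produces the constant \<open>2 powr p\<close>.\<close>
  have "summable (\<lambda>k. ?V * 2 ^ ?d * 2 powr p * real (Suc k) powr (- p))"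
    using p summable_Suc_iff[of "\<lambda>k. real k powr (- p)"] summable_real_powr_iff[of "- p"]
    by (intro summable_mult) auto
  then have "summable a"
  proof (rule summable_comparison_test[rotated], intro exI allI impI)
    fix k :: nat
    have "1 / 2 \<le> ln (2::real)" using ln2_ge_two_thirds by simp
    moreover have "real ?d \<ge> 1" using DIM_positive[where 'a='a] by linarith
    ultimately have "1 * (1 / 2) \<le> real ?d * ln 2" by (intro mult_mono) auto
    then have "real k * (1 / 2) \<le> real k * (real ?d * ln 2)" by (intro mult_left_mono) auto
    then have "real (Suc k) / 2 \<le> 1 + real ?d * real k * ln 2" by (simp add: ac_simps)
    then have "(1 + real ?d * real k * ln 2) powr (- p) \<le> (real (Suc k) / 2) powr (- p)"
      using p by (intro powr_mono2') auto
    also have "\<dots> = 2 powr p * real (Suc k) powr (- p)"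
      by (simp add: powr_divide powr_minus field_simps)
    finally show "norm (a k) \<le> ?V * 2 ^ ?d * 2 powr p * real (Suc k) powr (- p)"
      using a0[of k] by (simp add: a_eq mult_left_mono mult.assoc)
  qed
  have "(\<integral>\<^sup>+y. ennreal (weight ?d p (1 + (norm y)\<^sup>2)) \<partial>(lborel :: 'a measure))
      \<le> (\<integral>\<^sup>+y. (\<Sum>k. ennreal (c k) * indicator (?B k) y) \<partial>lborel)"
    by (intro nn_integral_mono bound)
  also have "\<dots> = (\<Sum>k. \<integral>\<^sup>+y. ennreal (c k) * indicator (?B k) y \<partial>lborel)"
    by (intro nn_integral_suminf borel_measurable_times_ennreal borel_measurable_indicator) auto
  also have "\<dots> = (\<Sum>k. ennreal (a k))"
    by (simp add: nn_integral_cmult_indicator emeasure_ball a_def c_def ennreal_mult weight_nonneg)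
  also have "\<dots> < \<infinity>"
    using ennreal_suminf_neq_top[OF \<open>summable a\<close> a0] by (simp add: less_top)
  finally show ?thesis .
qed

subsection \<open>The weight as a function of the matrix entries\<close>

text \<open>The index 0 contributes the empty determinant 1, so this is the product of the minors of
  orders 1 to n - 1.\<close>

definition minor_prod :: "nat \<Rightarrow> 'a::rc_field mat \<Rightarrow> real" where
  "minor_prod n v = (\<Prod>j<n. gram_minor j v)"

lemma gram_minor_unip_full:
  fixes x :: "nat \<times> nat \<Rightarrow> 'a::rc_field"
  shows "gram_minor n (unip n x) = 1"
proof -
  let ?v = "unip n x"
  have v: "?v \<in> carrier_mat n n" "Determinant.det ?v = 1"
    using unip_N_grp[of n x] by (auto simp: N_grp_def SL_grp_def)
  note v' = mat_adjoint_carrier[OF v(1)]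
  have "Matrix.mat n n (\<lambda>p. (?v * mat_adjoint ?v) $$ p) = ?v * mat_adjoint ?v"
    using v(1) v' by (intro eq_matI) auto
  then show ?thesis
    by (simp add: gram_minor_def det_mult[OF v(1) v'] det_mat_adjoint[OF v(1)] v(2) conjugate_one)
qed

text \<open>The minor of order j equals 1 at size j, and every further column multiplies it by some
  s_j \<ge> 1. This keeps the logarithms in the weight nonnegative.\<close>

lemma gram_minor_unip_ge_1:
  fixes x :: "nat \<times> nat \<Rightarrow> 'a::rc_field"
  shows "j \<le> n \<Longrightarrow> gram_minor j (unip n x) \<ge> 1"
proof (induction n)
  case 0
  then show ?case using gram_minor_unip_full[of 0 x] by simp
next
  case (Suc m)
  show ?case
  proof (cases "j = Suc m")
    case True
    then show ?thesis using gram_minor_unip_full[of "Suc m" x] by simp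
  next
    case False
    obtain L r where "cholesky m (unip m x) L r" using ex_cholesky_unip by blast
    then have "gram_minor j (unip (Suc m) x) =
        gram_minor j (unip m x) * partial_norm (forward_subst L (\<lambda>i. x (i, m))) j"
      using False Suc.prems by (intro gram_minor_step) auto
    moreover have "gram_minor j (unip m x) \<ge> 1" using False Suc by auto
    ultimately show ?thesis
      using mult_mono[of 1 _ 1, OF _ partial_norm_ge_1] by fastforce
  qed
qed

lemma minor_prod_ge_1: "minor_prod n (unip n (x :: nat \<times> nat \<Rightarrow> 'a::rc_field)) \<ge> 1"
  unfolding minor_prod_def by (intro prod_ge_1 gram_minor_unip_ge_1) auto

text \<open>Replaces the definite description of the A-component by minors of the Gram matrix, for
  which both measurability and the recursion on columns are accessible.\<close>

lemma iwasawa_weight: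
  fixes x :: "nat \<times> nat \<Rightarrow> 'a::rc_field"
  shows "inverse (rho_pow n (iwasawa_a n (unip n x))) * (1 + rho_log n (iwasawa_a n (unip n x))) powr (- p)
    = weight DIM('a) p (minor_prod n (unip n x))"
proof -
  let ?v = "unip n x" and ?a = "iwasawa_a n (unip n x)" and ?q = "minor_prod n (unip n x)"
  obtain L r where ch: "cholesky n ?v L r" using ex_cholesky_unip by blast
  then have *: "L \<in> carrier_mat n n" "lower_triangular L" "\<And>i. i < n \<Longrightarrow> r i > 0"
      "\<And>i. i < n \<Longrightarrow> L $$ (i, i) = of_real (r i)" "L * mat_adjoint L = ?v * mat_adjoint ?v"
    by (auto simp: cholesky_def)
  have v: "?v \<in> SL_grp n" using unip_N_grp[of n x] by (simp add: N_grp_def)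
  note a = iwasawa_a_cholesky[OF v *]
  have "rho_pow n ?a = sqrt ((\<Prod>j<n. \<Prod>i<j. (norm (?a $$ (i, i)))\<^sup>2) ^ DIM('a))"
    by (rule rho_pow_A_grp[OF a(1)])
  also have "(\<Prod>j<n. \<Prod>i<j. (norm (?a $$ (i, i)))\<^sup>2) = (\<Prod>j<n. \<Prod>i<j. (r i)\<^sup>2)"
    using a(2) by (intro prod.cong refl) auto
  also have "\<dots> = ?q"
    unfolding minor_prod_def by (intro prod.cong refl gram_minor_cholesky[OF ch, symmetric]) auto
  finally have "rho_pow n ?a = sqrt (?q ^ DIM('a))" .
  moreover have q: "?q \<ge> 1" by (rule minor_prod_ge_1)
  ultimately have rho: "rho_pow n ?a = ?q powr (real DIM('a) / 2)"
    by (simp add: powr_half_sqrt[symmetric] powr_realpow[symmetric] powr_powr)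
  have rho_log: "rho_log n ?a = real DIM('a) / 2 * ln ?q"
    using q by (simp add: rho_log_def rho ln_powr)
  show ?thesis by (simp only: weight_def rho rho_log powr_minus)
qed

lemma conjugate_measurable: "conjugate \<in> borel_measurable (borel :: 'a::rc_field measure)"
proof -
  have "dist (conjugate x) (conjugate y) = dist x (y :: 'a)" for x y
    using norm_conjugate[of "x + - y"] by (simp only: conjugate_dist_add conjugate_neg dist_norm) simp
  then show ?thesis
    by (intro borel_measurable_continuous_onI) (auto simp: continuous_on_iff)
qed

text \<open>By the Leibniz formula the minor is the norm of a polynomial in the coordinates and
  their conjugates. Cholesky factors come pointwise from an existence statement, which carries no
  measurability.\<close>

lemma gram_minor_measurable:
  assumes j: "j \<le> n"
  shows "(\<lambda>x. gram_minor j (unip n x :: 'a::rc_field mat)) \<in>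
    borel_measurable (Pi\<^sub>M (upper_index n) (\<lambda>_. lborel))"
proof -
  let ?M = "Pi\<^sub>M (upper_index n) (\<lambda>_. lborel :: 'a measure)"
  have [measurable]: "(\<lambda>x. unip n x $$ (i, k)) \<in> borel_measurable ?M" if "i < n" "k < n" for i k
  proof (cases "i < k")
    case True
    then have "(\<lambda>x. x (i, k)) \<in> borel_measurable ?M"
      using that by (intro measurable_PiM_lborel_component) (auto simp: upper_index_def)
    then show ?thesis using True that by (simp add: unip_def)
  qed (use that in \<open>simp add: unip_def\<close>)
  note conjugate_measurable[measurable]
  have v: "unip n x \<in> carrier_mat n n" for x :: "nat \<times> nat \<Rightarrow> 'a" by (simp add: unip_def)
  have entry: "(\<lambda>x. (unip n x * mat_adjoint (unip n x)) $$ (i, l)) \<in> borel_measurable ?M"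
    if "i < n" "l < n" for i l
    unfolding index_mult_adjoint[OF v v that] using that
    by (intro borel_measurable_sum borel_measurable_times measurable_compose[OF _ conjugate_measurable]) auto
  have "(\<lambda>x. \<Prod>i = 0..<j. Matrix.mat j j (\<lambda>q. (unip n x * mat_adjoint (unip n x)) $$ q) $$ (i, p i))
      \<in> borel_measurable ?M" if "p permutes {0..<j}" for p
  proof (intro borel_measurable_prod)
    fix i assume i: "i \<in> {0..<j}"
    then have "p i < j" using permutes_in_image[OF that, of i] by auto
    then show "(\<lambda>x. Matrix.mat j j (\<lambda>q. (unip n x * mat_adjoint (unip n x)) $$ q) $$ (i, p i)) \<in> borel_measurable ?M"
      using i j entry[of i "p i"] by (simp del: index_mult_mat)
  qed
  then show ?thesis
    unfolding gram_minor_def det_def'[OF mat_carrier]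
    by (intro measurable_compose[OF _ borel_measurable_norm] borel_measurable_sum borel_measurable_times) auto
qed

lemma weight_minor_prod_measurable:
  "(\<lambda>x. weight d p (minor_prod n (unip n x :: 'a::rc_field mat))) \<in>
    borel_measurable (Pi\<^sub>M (upper_index n) (\<lambda>_. lborel))"
proof -
  have [measurable]: "(\<lambda>x. minor_prod n (unip n x :: 'a mat)) \<in>
      borel_measurable (Pi\<^sub>M (upper_index n) (\<lambda>_. lborel))"
    unfolding minor_prod_def by (intro borel_measurable_prod gram_minor_measurable) auto
  show ?thesis unfolding weight_def by measurable
qed

subsection \<open>Induction on the size\<close>

lemma minor_prod_step:
  fixes x :: "nat \<times> nat \<Rightarrow> 'a::rc_field"
  assumes ch: "cholesky m (unip m x) L r"
  shows "minor_prod (Suc m) (unip (Suc m) x) =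
    minor_prod m (unip m x) * (\<Prod>j<m. partial_norm (forward_subst L (\<lambda>i. x (i, m))) (Suc j))"
proof -
  let ?y = "forward_subst L (\<lambda>i. x (i, m))"
  have "minor_prod (Suc m) (unip (Suc m) x) = (\<Prod>j<Suc m. gram_minor j (unip m x) * partial_norm ?y j)"
    unfolding minor_prod_def by (intro prod.cong refl gram_minor_step[OF ch]) auto
  also have "\<dots> = (\<Prod>j<Suc m. gram_minor j (unip m x)) * (\<Prod>j<Suc m. partial_norm ?y j)"
    by (rule prod.distrib)
  \<comment> \<open>The extra factor j = m is the full minor of the smaller unipotent matrix, which
    is 1. Likewise s_0 = 1 drops out below, leaving exactly one factor for each new
    coordinate.\<close>
  also have "(\<Prod>j<Suc m. gram_minor j (unip m x)) = minor_prod m (unip m x)"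
    by (simp add: minor_prod_def gram_minor_unip_full)
  also have "(\<Prod>j<Suc m. partial_norm ?y j) = (\<Prod>j<m. partial_norm ?y (Suc j))"
    by (simp only: prod.lessThan_Suc_shift partial_norm_0 mult_1_left)
  finally show ?thesis .
qed

text \<open>The exponent \<open>p\<close> goes to the smaller matrix and \<open>p'\<close> to each
  of the m new coordinates. Keeping only |y_j|^2 from each s_(j+1) separates the
  coordinates.\<close>

lemma weight_minor_prod_step:
  fixes x :: "nat \<times> nat \<Rightarrow> 'a::rc_field"
  assumes ch: "cholesky m (unip m x) L r" and p: "p \<ge> 0" "p' \<ge> 0"
  shows "weight d (p + real m * p') (minor_prod (Suc m) (unip (Suc m) x)) \<le>
    weight d p (minor_prod m (unip m x)) *
    (\<Prod>j<m. weight d p' (1 + (norm (forward_subst L (\<lambda>i. x (i, m)) j))\<^sup>2))"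
proof -
  let ?y = "forward_subst L (\<lambda>i. x (i, m))"
  have ge: "1 + (norm (?y j))\<^sup>2 \<le> partial_norm ?y (Suc j)" for j
    using partial_norm_ge_1[of ?y j] by (simp add: partial_norm_Suc)
  have "weight d (p + real m * p') (minor_prod (Suc m) (unip (Suc m) x)) \<le>
      weight d p (minor_prod m (unip m x)) * weight d (real m * p') (\<Prod>j<m. partial_norm ?y (Suc j))"
    unfolding minor_prod_step[OF ch] using p
    by (intro weight_mult minor_prod_ge_1 prod_ge_1 partial_norm_ge_1) auto
  also have "\<dots> \<le> weight d p (minor_prod m (unip m x)) * (\<Prod>j<m. weight d p' (partial_norm ?y (Suc j)))"
    using p by (intro mult_left_mono weight_prod partial_norm_ge_1 weight_nonneg) auto
  also have "\<dots> \<le> weight d p (minor_prod m (unip m x)) * (\<Prod>j<m. weight d p' (1 + (norm (?y j))\<^sup>2))"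
    using p ge by (intro mult_left_mono prod_mono conjI weight_antimono weight_nonneg) auto
  finally show ?thesis .
qed

lemma upper_index_Suc: "upper_index (Suc m) = upper_index m \<union> (\<lambda>i. (i, m)) ` {..<m}"
  by (auto simp: upper_index_def less_Suc_eq)

lemma finite_upper_index: "finite (upper_index n)"
  by (rule finite_subset[of _ "{..<n} \<times> {..<n}"]) (auto simp: upper_index_def)

text \<open>The excess \<epsilon> is arbitrary in the induction because every column consumes part
  of it.\<close>

lemma nn_integral_minor_prod_finite:
  assumes "\<epsilon> > 0"
  shows "(\<integral>\<^sup>+x. ennreal (weight DIM('a) (real (n choose 2) + \<epsilon>) (minor_prod n (unip n x :: 'a::rc_field mat)))
    \<partial>Pi\<^sub>M (upper_index n) (\<lambda>_. lborel)) < \<infinity>"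
  using assms
proof (induction n arbitrary: \<epsilon>)
  case 0
  have "upper_index 0 = {}" by (simp add: upper_index_def)
  then show ?case by (simp add: PiM_empty nn_integral_count_space_finite)
next
  case (Suc m)
  interpret product_sigma_finite "\<lambda>_ :: nat \<times> nat. lborel :: 'a measure" by standard
  \<comment> \<open>The excess is shared equally by m + 1 recipients: the smaller matrix and the m
    new coordinates. With binomial(m + 1, 2) = binomial(m, 2) + m, each coordinate receives 1 +
    \<delta>.\<close>
  define \<delta> where "\<delta> = \<epsilon> / real (Suc m)"
  have \<delta>: "\<delta> > 0" using Suc.prems by (simp add: \<delta>_def)
  let ?I = "upper_index m" and ?J = "(\<lambda>i. (i, m)) ` {..<m}"
  let ?p = "real (m choose 2) + \<delta>"
  let ?f = "\<lambda>x. ennreal (weight DIM('a) (real (Suc m choose 2) + \<epsilon>) (minor_prod (Suc m) (unip (Suc m) x :: 'a mat)))"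
  let ?h = "\<lambda>x. ennreal (weight DIM('a) ?p (minor_prod m (unip m x :: 'a mat)))"
  let ?g = "\<lambda>y::'a. ennreal (weight DIM('a) (1 + \<delta>) (1 + (norm y)\<^sup>2))"
  let ?K = "\<integral>\<^sup>+y. ?g y \<partial>lborel"
  have g: "?g \<in> borel_measurable borel" unfolding weight_def by measurable
  have K: "?K < \<infinity>" using \<delta> by (intro nn_integral_weight_finite) auto
  have "real (Suc m) * \<delta> = \<epsilon>" by (simp add: \<delta>_def)
  then have ex: "real (Suc m choose 2) + \<epsilon> = ?p + real m * (1 + \<delta>)"
    by (simp add: numeral_2_eq_2 algebra_simps)
  \<comment> \<open>\<open>L\<close> is chosen anew for each \<open>x\<close>, but the bound does
    not mention it, so no measurable choice of \<open>L\<close> is involved.\<close>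
  have inner: "(\<integral>\<^sup>+u. ?f (merge ?I ?J (x, u)) \<partial>Pi\<^sub>M ?J (\<lambda>_. lborel)) \<le> ?h x * ?K ^ m" for x
  proof -
    obtain L r where ch: "cholesky m (unip m x) L r" using ex_cholesky_unip by blast
    have r: "\<And>j. j < m \<Longrightarrow> r j > 0" "\<And>j. j < m \<Longrightarrow> L $$ (j, j) = of_real (r j)"
      using ch by (auto simp: cholesky_def)
    \<comment> \<open>The full Gram minor is 1, so the positive diagonal of \<open>L\<close> has
      product 1 and the Jacobian of u = L y is trivial.\<close>
    have "(\<Prod>j<m. r j)\<^sup>2 = 1"
      using gram_minor_cholesky[OF ch order_refl] gram_minor_unip_full[of m x]
      by (simp add: prod_power_distrib)
    moreover have "(\<Prod>j<m. r j) > 0" using r(1) by (intro prod_pos) auto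
    ultimately have r1: "(\<Prod>j<m. r j) = 1" by (simp add: power2_eq_1_iff)
    have rd: "(\<Prod>j<m. ennreal (r j ^ DIM('a))) = 1"
      using r(1) r1 by (subst prod_ennreal) (auto simp: prod_power_distrib[symmetric] less_imp_le)
    let ?G = "\<lambda>u. \<Prod>j<m. ?g (forward_subst L (\<lambda>i. u (i, m)) j)"
    have G: "?G \<in> borel_measurable (Pi\<^sub>M ?J (\<lambda>_. lborel))"
      by (intro borel_measurable_prod_ennreal measurable_compose[OF forward_subst_measurable g]) auto
    have bound: "?f (merge ?I ?J (x, u)) \<le> ?h x * ?G u" for u
    proof -
      define w where "w = merge ?I ?J (x, u)"
      \<comment> \<open>Merging in the last column does not touch the coordinates of the leading
        block, so the factor \<open>L\<close> found for \<open>x\<close> serves every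
        \<open>u\<close>.\<close>
      have wx: "unip m w = unip m x"
        by (rule eq_matI) (auto simp: unip_def w_def merge_def upper_index_def)
      have "w (i, m) = u (i, m)" if "i < m" for i
        using that by (auto simp: w_def merge_def upper_index_def)
      then have wu: "forward_subst L (\<lambda>i. w (i, m)) j = forward_subst L (\<lambda>i. u (i, m)) j" if "j < m" for j
        using that by (intro forward_subst_cong) auto
      have "?f w \<le> ennreal (weight DIM('a) ?p (minor_prod m (unip m w)) *
          (\<Prod>j<m. weight DIM('a) (1 + \<delta>) (1 + (norm (forward_subst L (\<lambda>i. w (i, m)) j))\<^sup>2)))"
        unfolding ex using ch \<delta> by (intro ennreal_leI weight_minor_prod_step) (auto simp: wx)
      also have "\<dots> = ?h x * (\<Prod>j<m. ?g (forward_subst L (\<lambda>i. w (i, m)) j))"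
        by (simp add: ennreal_mult weight_nonneg prod_nonneg prod_ennreal wx)
      also have "\<dots> = ?h x * ?G u"
        by (intro arg_cong2[where f = "(*)"] prod.cong refl) (simp add: wu)
      finally show ?thesis by (simp only: w_def)
    qed
    have "(\<integral>\<^sup>+u. ?f (merge ?I ?J (x, u)) \<partial>Pi\<^sub>M ?J (\<lambda>_. lborel)) \<le>
        (\<integral>\<^sup>+u. ?h x * ?G u \<partial>Pi\<^sub>M ?J (\<lambda>_. lborel))"
      by (intro nn_integral_mono bound)
    also have "\<dots> = ?h x * (\<integral>\<^sup>+u. ?G u \<partial>Pi\<^sub>M ?J (\<lambda>_. lborel))"
      by (rule nn_integral_cmult[OF G])
    also have "(\<integral>\<^sup>+u. ?G u \<partial>Pi\<^sub>M ?J (\<lambda>_. lborel)) = ?K ^ m"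
      by (subst nn_integral_forward_subst[OF g r]) (auto simp: rd)
    finally show ?thesis .
  qed
  have "(\<integral>\<^sup>+x. ?f x \<partial>Pi\<^sub>M (upper_index (Suc m)) (\<lambda>_. lborel)) =
      (\<integral>\<^sup>+x. \<integral>\<^sup>+u. ?f (merge ?I ?J (x, u)) \<partial>Pi\<^sub>M ?J (\<lambda>_. lborel) \<partial>Pi\<^sub>M ?I (\<lambda>_. lborel))"
    unfolding upper_index_Suc
  proof (rule product_nn_integral_fold)
    show "?I \<inter> ?J = {}" by (auto simp: upper_index_def)
    show "?f \<in> borel_measurable (Pi\<^sub>M (?I \<union> ?J) (\<lambda>_. lborel))"
      unfolding upper_index_Suc[symmetric]
      by (intro measurable_compose[OF weight_minor_prod_measurable measurable_ennreal])
  qed (auto simp: finite_upper_index)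
  also have "\<dots> \<le> (\<integral>\<^sup>+x. ?h x * ?K ^ m \<partial>Pi\<^sub>M ?I (\<lambda>_. lborel))"
    by (intro nn_integral_mono inner)
  also have "\<dots> = (\<integral>\<^sup>+x. ?h x \<partial>Pi\<^sub>M ?I (\<lambda>_. lborel)) * ?K ^ m"
    by (intro nn_integral_multc measurable_compose[OF weight_minor_prod_measurable measurable_ennreal])
  also have "\<dots> < \<infinity>"
    using Suc.IH[OF \<delta>] K by (simp add: ennreal_mult_less_top power_less_top_ennreal)
  finally show ?case .
qed

text \<open>Pulled back along \<open>unip\<close>, the integrand becomes a nonnegative measurable
  weight, so integrability amounts to finiteness of the integral bounded above.\<close>

lemma integrable_iwasawa_weight:
  assumes "\<epsilon> > 0"
  shows "integrable (haar_N n :: 'a::rc_field mat measure)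
    (\<lambda>v. inverse (rho_pow n (iwasawa_a n v)) *
         (1 + rho_log n (iwasawa_a n v)) powr (- real (n choose 2) - \<epsilon>))"
    (is "integrable _ ?F")
proof -
  let ?M = "Pi\<^sub>M (upper_index n) (\<lambda>_. lborel :: 'a measure)"
  have F: "?F (unip n x) = weight DIM('a) (real (n choose 2) + \<epsilon>) (minor_prod n (unip n x))"
    for x :: "nat \<times> nat \<Rightarrow> 'a"
    using iwasawa_weight[of n x "real (n choose 2) + \<epsilon>"] by simp
  have meas: "?F \<in> borel_measurable (haar_N n)"
    unfolding haar_N_def by (intro measurable_embed_measure1) (simp only: F weight_minor_prod_measurable)
  have "(\<integral>\<^sup>+v. ennreal (norm (?F v)) \<partial>haar_N n) = (\<integral>\<^sup>+x. ennreal (norm (?F (unip n x))) \<partial>?M)"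
    using meas unfolding haar_N_def
    by (intro nn_integral_embed_measure' inj_on_unip
        measurable_compose[OF measurable_compose[OF _ borel_measurable_norm] measurable_ennreal])
  also have "\<dots> = (\<integral>\<^sup>+x. ennreal (weight DIM('a) (real (n choose 2) + \<epsilon>) (minor_prod n (unip n x))) \<partial>?M)"
    by (simp only: F real_norm_def abs_of_nonneg[OF weight_nonneg])
  also have "\<dots> < \<infinity>" by (rule nn_integral_minor_prod_finite[OF assms])
  finally show ?thesis using meas by (simp add: integrable_iff_bounded)
qed

theorem theorem7:
  fixes n :: nat and \<epsilon> :: real
  assumes "n \<ge> 2" and "\<epsilon> > 0"
  shows "integrable (haar_N n :: real mat measure)
           (\<lambda>v. inverse (rho_pow n (iwasawa_a n v)) *
                (1 + rho_log n (iwasawa_a n v)) powr (- real (n choose 2) - \<epsilon>))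
       \<and> integrable (haar_N n :: complex mat measure)
           (\<lambda>v. inverse (rho_pow n (iwasawa_a n v)) *
                (1 + rho_log n (iwasawa_a n v)) powr (- real (n choose 2) - \<epsilon>))"
  by (intro conjI integrable_iwasawa_weight assms(2))

end
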